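(* Let $\varphi:\mathfrak{n}\to\mathbb{C}$ be a good character. The correspondence $$V\longmapsto A_V$$ sets up a bijection between the set of all isomorphism classes of Whittaker modules of type $\varphi$ for $\mathcal{B}$ and the set of all ideals of $A=S(Z)=\mathbb{C}[x_{(1,0)}]$.
   Context: Let $\mathcal{B}$ be the complex Lie algebra with basis $\{x_{(a,i)} : a\in\mathbb{Z},\ i\in\mathbb{N}\}$, $\mathbb{N}=\{0,1,2,\dots\}$, and bracket $[x_{(a,i)},x_{(b,j)}]=\big((b-1)i-(a-1)j\big)x_{(a+b,\,i+j-1)}$ (the coefficient is $0$ when $i=j=0$). Let $\mathfrak{n}=\mathrm{Span}_{\mathbb{C}}\{x_{(a,i)} : a+i>1\}$, a Lie subalgebra. Let $Z=\mathbb{C}x_{(1,0)}$ be the center of $\mathcal{B}$ and $A=S(Z)=\mathbb{C}[x_{(1,0)}]\subset\mathcal{U}(\mathcal{B})$, where $\mathcal{U}(\cdot)$ denotes the universal enveloping algebra. Let $\varphi:\mathfrak{n}\to\mathbb{C}$ be a Lie algebra homomorphism ($\mathbb{C}$ abelian). It is nonsingular if $\varphi(x_{(a,i)})\neq 0$ for all $(a,i)$ with $i\ge 0$ and $a+i=2$. For integers $n\ge1$, $s\ge 1$, let $H^{(n,s)}$ be the $\infty\times(n+1)$ matrix with rows indexed by $m\ge1$ and columns by $0\le j\le n$, whose $(m,j)$ entry is $\varphi(x_{(2-a,a)})$ with $a=m+j+s-1$. The homomorphism $\varphi$ is a good character if it is nonsingular and $\mathrm{rank}(H^{(n,s)})=n+1$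 for all $n\ge1$, $s\ge1$. For a $\mathcal{B}$-module $V$, a vector $v\in V$ is a Whittaker vector of type $\varphi$ if $xv=\varphi(x)v$ for all $x\in\mathfrak{n}$ (the zero vector is allowed). $V$ is a Whittaker module of type $\varphi$ if it is generated by a Whittaker vector of type $\varphi$ (the zero module is allowed). For a Whittaker module $V$, let $\mathcal{U}_V(\mathcal{B})$ be the annihilator of $V$ in $\mathcal{U}(\mathcal{B})$ and $A_V=A\cap\mathcal{U}_V(\mathcal{B})$. *)

theory Defs
  imports
    "HOL-Algebra.Algebraic_Closure_Type"
    "HOL-Library.Poly_Mapping"
    "HOL-Library.Function_Algebras"
    "HOL-Computational_Algebra.Polynomial"
begin

section \<open>The Lie algebra \<open>\<B>\<close>\<close>

text \<open>Elements of \<open>\<B>\<close> are the finitely supported complex functions on \<open>\<int> \<times> \<nat>\<close>.\<close>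

type_synonym B = "(int \<times> nat) \<Rightarrow>\<^sub>0 complex"

definition xB :: "int \<times> nat \<Rightarrow> B"
  where "xB p = Poly_Mapping.single p 1"

definition B_scale :: "complex \<Rightarrow> B \<Rightarrow> B"
  where "B_scale c x = Poly_Mapping.map ((*) c) x"

interpretation B: vector_space B_scale
  by standard
    (auto intro!: poly_mapping_eqI
      simp: B_scale_def lookup_add Poly_Mapping.map.rep_eq when_def algebra_simps
        simp flip: distrib_left)

definition xB_bracket :: "int \<times> nat \<Rightarrow> int \<times> nat \<Rightarrow> B"
  where "xB_bracket = (\<lambda>(a, i) (b, j).
    B_scale (of_int ((b - 1) * int i - (a - 1) * int j)) (xB (a + b, i + j - 1)))"
  \<comment> \<open>for \<open>i = j = 0\<close> the coefficient vanishes, so the truncated subtraction is harmless\<close>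

definition B_bracket :: "B \<Rightarrow> B \<Rightarrow> B"
  where "B_bracket x y = (\<Sum>p\<in>Poly_Mapping.keys x. \<Sum>q\<in>Poly_Mapping.keys y.
    B_scale (Poly_Mapping.lookup x p * Poly_Mapping.lookup y q) (xB_bracket p q))"

lemma B_bracket_xB: "B_bracket (xB p) (xB q) = xB_bracket p q"
  by (simp add: B_bracket_def xB_def)

definition nil_part :: "B set"
  where "nil_part = B.span {xB (a, i) | a i. a + int i > 1}"


section \<open>Characters of \<open>\<nn>\<close>\<close>

text \<open>Only the values of \<open>\<phi>\<close> on \<^const>\<open>nil_part\<close> are relevant; outside of it \<open>\<phi>\<close> is arbitrary.\<close>

definition lie_character :: "(B \<Rightarrow> complex) \<Rightarrow> bool"
  where "lie_character \<phi> \<longleftrightarrow>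
    (\<forall>x\<in>nil_part. \<forall>y\<in>nil_part. \<phi> (x + y) = \<phi> x + \<phi> y) \<and>
    (\<forall>c. \<forall>x\<in>nil_part. \<phi> (B_scale c x) = c * \<phi> x) \<and>
    (\<forall>x\<in>nil_part. \<forall>y\<in>nil_part. \<phi> (B_bracket x y) = 0)"

definition nonsingular :: "(B \<Rightarrow> complex) \<Rightarrow> bool"
  where "nonsingular \<phi> \<longleftrightarrow> (\<forall>a i. a + int i = 2 \<longrightarrow> \<phi> (xB (a, i)) \<noteq> 0)"

interpretation fun_space: vector_space "\<lambda>(c::complex) f (m::nat). c * f m"
  by standard (auto simp: fun_eq_iff algebra_simps)

text \<open>Column rank of the matrix \<open>M\<close> with rows \<open>R\<close> and columns \<open>C\<close>; columns are extended by
  \<open>0\<close> outside of \<open>R\<close>.\<close>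

definition matrix_rank :: "nat set \<Rightarrow> nat set \<Rightarrow> (nat \<Rightarrow> nat \<Rightarrow> complex) \<Rightarrow> nat"
  where "matrix_rank R C M = fun_space.dim ((\<lambda>j m. if m \<in> R then M m j else 0) ` C)"

definition H_matrix :: "(B \<Rightarrow> complex) \<Rightarrow> nat \<Rightarrow> nat \<Rightarrow> nat \<Rightarrow> complex"
  where "H_matrix \<phi> s m j = (let a = m + j + s - 1 in \<phi> (xB (2 - int a, a)))"

definition good_character :: "(B \<Rightarrow> complex) \<Rightarrow> bool"
  where "good_character \<phi> \<longleftrightarrow> lie_character \<phi> \<and> nonsingular \<phi> \<and>
    (\<forall>n\<ge>1. \<forall>s\<ge>1. matrix_rank {1..} {0..n} (H_matrix \<phi> s) = n + 1)"


section \<open>The universal enveloping algebra\<close>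

text \<open>The tensor algebra of \<open>\<B>\<close> is realised as the free associative algebra on the basis of
  \<open>\<B>\<close>, i.e. as the monoid algebra of the free monoid of words.\<close>

datatype 'a word = Word (letters: "'a list")

instantiation word :: (type) monoid_add
begin

definition zero_word :: "'a word"
  where "zero_word = Word []"

definition plus_word :: "'a word \<Rightarrow> 'a word \<Rightarrow> 'a word"
  where "plus_word u v = Word (letters u @ letters v)"

instance
  by standard (simp_all add: zero_word_def plus_word_def)

end

type_synonym TB = "(int \<times> nat) word \<Rightarrow>\<^sub>0 complex"

abbreviation tensor_alg :: "TB ring"
  where "tensor_alg \<equiv> ring_of_type_algebra"

definition \<iota> :: "B \<Rightarrow> TB"
  where "\<iota> x =
    (\<Sum>p\<in>Poly_Mapping.keys x. Poly_Mapping.single (Word [p]) (Poly_Mapping.lookup x p))"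

definition U_ideal :: "TB set"
  where "U_ideal = Idl\<^bsub>tensor_alg\<^esub> {\<iota> x * \<iota> y - \<iota> y * \<iota> x - \<iota> (B_bracket x y) | x y. True}"

definition U_alg :: "TB set ring"
  where "U_alg = tensor_alg Quot U_ideal"

definition U_proj :: "TB \<Rightarrow> TB set"
  where "U_proj t = U_ideal +>\<^bsub>tensor_alg\<^esub> t"

text \<open>\<open>A = \<complex>[x\<^bsub>(1,0)\<^esub>]\<close> as a subalgebra of \<^const>\<open>U_alg\<close>: the values of all complex polynomials
  at the image of \<open>x\<^bsub>(1,0)\<^esub>\<close>. In \<^typ>\<open>TB\<close>, \<open>Poly_Mapping.single 0 c\<close> is the scalar \<open>c\<close>.\<close>

definition poly_in_center :: "complex poly \<Rightarrow> TB"
  where "poly_in_center p =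
    (\<Sum>k\<le>degree p. Poly_Mapping.single 0 (coeff p k) * \<iota> (xB (1, 0)) ^ k)"

definition A_carrier :: "TB set set"
  where "A_carrier = {U_proj (poly_in_center p) | p. True}"

definition A_alg :: "TB set ring"
  where "A_alg = U_alg\<lparr>carrier := A_carrier\<rparr>"


section \<open>\<open>\<B>\<close>-modules\<close>

abbreviation complex_ring :: "complex ring"
  where "complex_ring \<equiv> ring_of_type_algebra"

text \<open>The fields \<^const>\<open>mult\<close> and \<^const>\<open>one\<close> inherited from the library's module record carry no
  meaning here.\<close>

record 'v B_mod = "(complex, 'v) module" +
  act :: "B \<Rightarrow> 'v \<Rightarrow> 'v"

definition B_module :: "'v B_mod \<Rightarrow> bool"
  where "B_module V \<longleftrightarrow> module complex_ring V \<and>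
    (\<forall>x. \<forall>v\<in>carrier V. act V x v \<in> carrier V) \<and>
    (\<forall>x. \<forall>v\<in>carrier V. \<forall>w\<in>carrier V. act V x (v \<oplus>\<^bsub>V\<^esub> w) = act V x v \<oplus>\<^bsub>V\<^esub> act V x w) \<and>
    (\<forall>x c. \<forall>v\<in>carrier V. act V x (c \<odot>\<^bsub>V\<^esub> v) = c \<odot>\<^bsub>V\<^esub> act V x v) \<and>
    (\<forall>x y. \<forall>v\<in>carrier V. act V (x + y) v = act V x v \<oplus>\<^bsub>V\<^esub> act V y v) \<and>
    (\<forall>x c. \<forall>v\<in>carrier V. act V (B_scale c x) v = c \<odot>\<^bsub>V\<^esub> act V x v) \<and>
    (\<forall>x y. \<forall>v\<in>carrier V.
      act V (B_bracket x y) v = act V x (act V y v) \<ominus>\<^bsub>V\<^esub> act V y (act V x v))"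

definition B_submodule :: "'v set \<Rightarrow> 'v B_mod \<Rightarrow> bool"
  where "B_submodule W V \<longleftrightarrow> submodule W complex_ring V \<and> (\<forall>x. \<forall>w\<in>W. act V x w \<in> W)"

definition generated_by :: "'v B_mod \<Rightarrow> 'v \<Rightarrow> bool"
  where "generated_by V v \<longleftrightarrow>
    v \<in> carrier V \<and> (\<forall>W. B_submodule W V \<and> v \<in> W \<longrightarrow> W = carrier V)"

definition B_iso :: "'v B_mod \<Rightarrow> 'w B_mod \<Rightarrow> bool"
  where "B_iso V W \<longleftrightarrow> (\<exists>f. bij_betw f (carrier V) (carrier W) \<and>
    (\<forall>v\<in>carrier V. \<forall>w\<in>carrier V. f (v \<oplus>\<^bsub>V\<^esub> w) = f v \<oplus>\<^bsub>W\<^esub> f w) \<and>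
    (\<forall>c. \<forall>v\<in>carrier V. f (c \<odot>\<^bsub>V\<^esub> v) = c \<odot>\<^bsub>W\<^esub> f v) \<and>
    (\<forall>x. \<forall>v\<in>carrier V. f (act V x v) = act W x (f v)))"

definition whittaker_vector :: "(B \<Rightarrow> complex) \<Rightarrow> 'v B_mod \<Rightarrow> 'v \<Rightarrow> bool"
  where "whittaker_vector \<phi> V v \<longleftrightarrow>
    v \<in> carrier V \<and> (\<forall>x\<in>nil_part. act V x v = \<phi> x \<odot>\<^bsub>V\<^esub> v)"

definition whittaker_module :: "(B \<Rightarrow> complex) \<Rightarrow> 'v B_mod \<Rightarrow> bool"
  where "whittaker_module \<phi> V \<longleftrightarrow>
    B_module V \<and> (\<exists>v. whittaker_vector \<phi> V v \<and> generated_by V v)"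

text \<open>The action of the tensor algebra that extends \<^const>\<open>act\<close>. It factors through
  \<^const>\<open>U_alg\<close>, so an element of \<^const>\<open>U_alg\<close> (a coset) acts by any of its representatives.\<close>

definition T_act :: "'v B_mod \<Rightarrow> TB \<Rightarrow> 'v \<Rightarrow> 'v"
  where "T_act V t v = (\<Oplus>\<^bsub>V\<^esub>w\<in>Poly_Mapping.keys t.
    Poly_Mapping.lookup t w \<odot>\<^bsub>V\<^esub> foldr (\<lambda>p. act V (xB p)) (letters w) v)"

definition U_annihilator :: "'v B_mod \<Rightarrow> TB set set"
  where "U_annihilator V =
    {u \<in> carrier U_alg. \<forall>t\<in>u. \<forall>v\<in>carrier V. T_act V t v = \<zero>\<^bsub>V\<^esub>}"

definition A_annihilator :: "'v B_mod \<Rightarrow> TB set set"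
  where "A_annihilator V = A_carrier \<inter> U_annihilator V"

text \<open>Isomorphism classes are formed among the modules whose underlying set consists of elements
  of the type \<^typ>\<open>'v\<close>. The type \<^typ>\<open>TB set\<close> is large enough to contain all of them up to
  isomorphism: a cyclic module is a quotient of the tensor algebra by a left ideal, and its
  elements are then cosets.\<close>

definition whittaker_iso :: "(B \<Rightarrow> complex) \<Rightarrow> ('v B_mod \<times> 'v B_mod) set"
  where "whittaker_iso \<phi> =
    {(V, W). whittaker_module \<phi> V \<and> whittaker_module \<phi> W \<and> B_iso V W}"

definition whittaker_classes :: "(B \<Rightarrow> complex) \<Rightarrow> 'v B_mod set set"
  where "whittaker_classes \<phi> = {V. whittaker_module \<phi> V} // whittaker_iso \<phi>"

end

theory Submission
  imports Defs "HOL-Library.Product_Lexorder"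
begin

text \<open>Write \<open>e\<^bsub>k,i\<^esub> = x\<^bsub>(k+1-i,i)\<^esub>\<close>, so that \<open>[e\<^bsub>k,i\<^esub>, e\<^bsub>l,j\<^esub>] = (l i - k j) e\<^bsub>k+l,i+j-1\<^esub>\<close>: the algebra is graded by
  \<open>k\<close>, \<open>\<nn>\<close> is the part of positive degree, and the centre is spanned by \<open>z = e\<^bsub>0,0\<^esub>\<close>. By the
  Poincare-Birkhoff-Witt argument the module induced from the character \<open>e\<^bsub>1,i\<^esub> \<mapsto> \<phi> e\<^bsub>1,i\<^esub>\<close>,
  \<open>z \<mapsto> X\<close> of \<open>\<nn> \<oplus> \<complex> z\<close> is free over \<open>\<complex>[X]\<close> on the monomials in the remaining \<open>e\<^bsub>k,i\<^esub>\<close>, \<open>k \<le> 0\<close>.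
  The point is that a submodule \<open>K\<close> of it is determined by the ideal \<open>I\<close> of all \<open>f\<close> with
  \<open>f \<cdot> 1 \<in> K\<close>: the coefficients of every element of \<open>K\<close> lie in \<open>I\<close>. To see this, take the
  coefficients modulo \<open>I\<close> and look at the longest monomials of an element of \<open>K\<close>. If \<open>-d < 0\<close> is the
  least degree of a letter in them, then \<open>e\<^bsub>d,j\<^esub>\<close> turns letters \<open>e\<^bsub>-d,i\<^esub>\<close> into \<open>e\<^bsub>0,i+j-1\<^esub>\<close>; for
  large \<open>j\<close> nothing cancels, and only letters of degree \<open>0\<close> remain eventually. On those,
  \<open>e\<^bsub>1,j\<^esub> - \<phi> e\<^bsub>1,j\<^esub>\<close> deletes a letter and produces the factor \<open>-i \<phi> e\<^bsub>1,i+j-1\<^esub>\<close>, and the rank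
  condition on the Hankel matrices makes the shorter element nonzero for some large \<open>j\<close>.\<close>

text \<open>A Whittaker module is the quotient of the tensor algebra by the annihilator
  \<open>J\<close> of its generator, a left ideal containing \<open>U_ideal\<close> and all
  \<open>letter p - single 0 (\<phi> (xB p))\<close> with \<open>p\<close> of positive degree.
  Modulo \<open>J\<close> each \<open>t\<close> is congruent to a normal form of its value at
  \<open>1\<close> in the induced module, so \<open>J\<close> corresponds to an invariant subspace
  and is fixed by the polynomials in \<open>z\<close> that it contains. A polynomial in
  \<open>z\<close> kills the module as soon as it kills the generator, so these are the polynomials
  whose images in \<open>U_alg\<close> make up \<open>A_V\<close>. Conversely, the elements with all
  coefficients in a given ideal form an invariant subspace, and its quotient kills no further
  polynomials, as \<open>f(z)\<close> sends \<open>1\<close> to \<open>f \<cdot> 1\<close>. All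
  ideals share one module over \<open>\<complex>[X]\<close>: instead of passing to the quotient
  ring, which may have zero divisors, the proof deletes the coefficients that lie in the ideal.
  Division remains possible because the structure constants are integers and the Hankel entries are
  complex numbers.\<close>

abbreviation "lookup \<equiv> Poly_Mapping.lookup"
abbreviation "single \<equiv> Poly_Mapping.single"
abbreviation "keys \<equiv> Poly_Mapping.keys"

section \<open>Linear extension\<close>

text \<open>In a monoid algebra the scalars are the multiples of the neutral monomial.
  Multiplication by \<open>single 0 a\<close> serves as scaling throughout.\<close>

lemma lookup_scalar_mult [simp]:
  fixes u :: "'w::monoid_add \<Rightarrow>\<^sub>0 'r::semiring_0"
  shows "lookup (single 0 a * u) w = a * lookup u w"
  by (simp flip: mult_map_scale_conv_mult add: Poly_Mapping.map.rep_eq when_def)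

definition supported_on :: "'w set \<Rightarrow> ('w \<Rightarrow>\<^sub>0 'r::zero) set"
  where "supported_on S = {u. keys u \<subseteq> S}"

lemma supported_onI: "(\<And>w. w \<notin> S \<Longrightarrow> lookup u w = 0) \<Longrightarrow> u \<in> supported_on S"
  by (auto simp: supported_on_def in_keys_iff)

lemma supported_onD: "u \<in> supported_on S \<Longrightarrow> w \<notin> S \<Longrightarrow> lookup u w = 0"
  by (auto simp: supported_on_def in_keys_iff)

lemma supported_on_mono: "u \<in> supported_on S \<Longrightarrow> S \<subseteq> T \<Longrightarrow> u \<in> supported_on T"
  by (auto simp: supported_on_def)

lemma supported_on_0 [simp]: "0 \<in> supported_on S"
  by (simp add: supported_on_def)

lemma supported_on_add:
  "u \<in> supported_on S \<Longrightarrow> v \<in> supported_on S \<Longrightarrow> u + v \<in> supported_on S"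
  by (rule supported_onI) (simp add: lookup_add supported_onD)

lemma supported_on_diff:
  fixes u :: "'w \<Rightarrow>\<^sub>0 'r::ab_group_add"
  shows "u \<in> supported_on S \<Longrightarrow> v \<in> supported_on S \<Longrightarrow> u - v \<in> supported_on S"
  by (rule supported_onI) (simp add: lookup_minus supported_onD)

lemma supported_on_scalar_mult:
  fixes u :: "'w::monoid_add \<Rightarrow>\<^sub>0 'r::semiring_0"
  shows "u \<in> supported_on S \<Longrightarrow> single 0 a * u \<in> supported_on S"
  by (rule supported_onI) (simp add: supported_onD)

lemma supported_on_sum:
  "(\<And>i. i \<in> A \<Longrightarrow> f i \<in> supported_on S) \<Longrightarrow> sum f A \<in> supported_on S"
  by (rule supported_onI) (auto simp: lookup_sum intro!: sum.neutral supported_onD)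

lemma supported_on_single: "w \<in> S \<Longrightarrow> single w a \<in> supported_on S"
  by (auto simp: supported_on_def)

definition lin_ext :: "('k \<Rightarrow> 'w::monoid_add \<Rightarrow>\<^sub>0 'r::comm_ring_1) \<Rightarrow> ('k \<Rightarrow>\<^sub>0 'r) \<Rightarrow> 'w \<Rightarrow>\<^sub>0 'r"
  where "lin_ext f u = (\<Sum>k\<in>keys u. single 0 (lookup u k) * f k)"

lemma lin_ext_superset:
  assumes "finite A" "keys u \<subseteq> A"
  shows "lin_ext f u = (\<Sum>k\<in>A. single 0 (lookup u k) * f k)"
  unfolding lin_ext_def using assms
  by (intro sum.mono_neutral_left) (auto simp: in_keys_iff)

lemma lin_ext_0 [simp]: "lin_ext f 0 = 0"
  by (simp add: lin_ext_def)

lemma lin_ext_single [simp]: "lin_ext f (single k a) = single 0 a * f k"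
  by (simp add: lin_ext_superset[of "{k}"])

lemma lin_ext_add: "lin_ext f (u + v) = lin_ext f u + lin_ext f v"
proof -
  let ?A = "keys u \<union> keys v"
  have "keys (u + v) \<subseteq> ?A" by (rule keys_add)
  then show ?thesis
    by (simp add: lin_ext_superset[of ?A] lookup_add single_add distrib_right sum.distrib)
qed

lemma lin_ext_scalar_mult:
  fixes u :: "'k::monoid_add \<Rightarrow>\<^sub>0 'r::comm_ring_1"
  shows "lin_ext f (single 0 a * u) = single 0 a * lin_ext f u"
proof -
  have "keys (single 0 a * u) \<subseteq> keys u"
    by (auto simp: in_keys_iff)
  then show ?thesis
    by (simp add: lin_ext_superset[of "keys u"] sum_distrib_left mult.assoc [symmetric] mult_single)
qed

lemma lin_ext_uminus: "lin_ext f (- u) = - lin_ext f u"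
  using lin_ext_add[of f u "- u"] by (simp add: add_eq_0_iff)

lemma lin_ext_diff: "lin_ext f (u - v) = lin_ext f u - lin_ext f v"
  using lin_ext_add[of f u "- v"] by (simp add: lin_ext_uminus)

lemma lin_ext_sum: "lin_ext f (sum g A) = (\<Sum>i\<in>A. lin_ext f (g i))"
  by (induction A rule: infinite_finite_induct) (auto simp: lin_ext_add)

lemma lin_ext_supported_on:
  assumes "u \<in> supported_on S" "\<And>w. w \<in> S \<Longrightarrow> f w \<in> supported_on T"
  shows "lin_ext f u \<in> supported_on T"
  unfolding lin_ext_def using assms
  by (intro supported_on_sum supported_on_scalar_mult) (auto simp: supported_on_def)

lemma lin_ext_cong:
  assumes "u \<in> supported_on S" "\<And>w. w \<in> S \<Longrightarrow> f w = g w"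
  shows "lin_ext f u = lin_ext g u"
  unfolding lin_ext_def using assms
  by (intro sum.cong) (auto simp: supported_on_def)

lemma lin_ext_fun_diff: "lin_ext (\<lambda>w. f w - g w) u = lin_ext f u - lin_ext g u"
  by (simp add: lin_ext_def right_diff_distrib sum_subtractf)

lemma lin_ext_monomial [simp]:
  fixes u :: "'w::monoid_add \<Rightarrow>\<^sub>0 'r::comm_ring_1"
  shows "lin_ext (\<lambda>w. single w 1) u = u"
proof (rule poly_mapping_eqI)
  fix k
  have "lookup (lin_ext (\<lambda>w. single w 1) u) k = (\<Sum>w\<in>insert k (keys u). if w = k then lookup u k else 0)"
    by (simp add: lin_ext_superset[of "insert k (keys u)"] lookup_sum lookup_single when_def
        subset_insertI if_distrib cong: if_cong)
  also have "\<dots> = lookup u k" by simp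
  finally show "lookup (lin_ext (\<lambda>w. single w 1) u) k = lookup u k" .
qed

lemma lin_ext_mult_monomial:
  fixes v :: "'w::comm_monoid_add \<Rightarrow>\<^sub>0 'r::comm_ring_1"
  shows "lin_ext (\<lambda>w. v * f w) u = v * lin_ext f u"
  by (simp add: lin_ext_def sum_distrib_left mult.left_commute)

section \<open>The module induced from a character\<close>

text \<open>A Lie algebra over \<open>'r\<close> given by a basis in which \<open>[p, q]\<close> is
  the multiple \<open>c p q\<close> of the single basis element \<open>b p q\<close>. The basis
  elements outside \<open>P\<close> span a subalgebra with character \<open>\<chi>\<close>. In
  \<open>jacobi\<close> the arbitrary \<open>f\<close> stands for a linear functional, which states
  the Jacobi identity without forming the Lie algebra.\<close>

locale induced_module =
  fixes c :: "'a::linorder \<Rightarrow> 'a \<Rightarrow> 'r::comm_ring_1"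
    and b :: "'a \<Rightarrow> 'a \<Rightarrow> 'a"
    and P :: "'a set"
    and \<chi> :: "'a \<Rightarrow> 'r"
  assumes c_self: "c p p = 0"
    and c_anti: "c q p = - c p q"
    and b_comm: "b q p = b p q"
    and jacobi: "c q r * c p (b q r) * f (b p (b q r)) + c r p * c q (b r p) * f (b q (b r p))
      + c p q * c r (b p q) * f (b r (b p q)) = 0"
    and subalgebra: "p \<notin> P \<Longrightarrow> q \<notin> P \<Longrightarrow> c p q \<noteq> 0 \<Longrightarrow> b p q \<notin> P \<and> \<chi> (b p q) = 0"
begin

definition top :: "'a \<Rightarrow> 'a multiset \<Rightarrow> 'a multiset \<Rightarrow>\<^sub>0 'r"
  where "top p w = (if p \<in> P then single (add_mset p w) 1 else 0)"

text \<open>The letters of \<open>P\<close> precede those of its complement, so straightening a word \<open>p w\<close> leaves the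
  sorted word \<open>top p w\<close> plus the shorter words \<open>low p w\<close>. The bound on \<open>size w\<close> always holds; it is
  there for termination.\<close>

function low :: "'a \<Rightarrow> 'a list \<Rightarrow> 'a multiset \<Rightarrow>\<^sub>0 'r"
  where
    "low p [] = (if p \<in> P then 0 else single 0 (\<chi> p))"
  | "low p (q # xs) = (if p \<in> P \<and> p \<le> q then 0 else
      (\<Sum>w\<in>{w \<in> keys (low p xs). size w \<le> length xs}. single 0 (lookup (low p xs) w) *
         (single (add_mset q w) 1 + low q (sorted_list_of_multiset w)))
      + single 0 (c p q) * (top (b p q) (mset xs) + low (b p q) xs))"
  by pat_completeness auto
termination
  by (relation "measure (\<lambda>(p, xs). length xs)")
    (auto simp flip: size_mset)

definition act1 :: "'a \<Rightarrow> 'a multiset \<Rightarrow> 'a multiset \<Rightarrow>\<^sub>0 'r"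
  where "act1 p w = top p w + low p (sorted_list_of_multiset w)"

definition op :: "'a \<Rightarrow> ('a multiset \<Rightarrow>\<^sub>0 'r) \<Rightarrow> 'a multiset \<Rightarrow>\<^sub>0 'r"
  where "op p = lin_ext (act1 p)"

lemma op_0 [simp]: "op p 0 = 0"
  and op_add: "op p (u + v) = op p u + op p v"
  and op_scalar_mult: "op p (single 0 a * u) = single 0 a * op p u"
  and op_sum: "op p (sum g A) = (\<Sum>i\<in>A. op p (g i))"
  by (simp_all add: op_def lin_ext_add lin_ext_scalar_mult lin_ext_sum)

lemma op_single: "op p (single w a) = single 0 a * act1 p w"
  by (simp add: op_def)

lemma op_monomial [simp]: "op p (single w 1) = act1 p w"
  by (simp add: op_def)

lemma op_one [simp]: "op p 1 = act1 p {#}"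
  using op_monomial[of p "{#}"] by simp

text \<open>Proved along the recursion of \<open>low\<close> itself. Afterwards the filter on
  \<open>size w\<close> in that recursion is known to discard nothing, and \<open>low_Cons\<close>
  can state the recursion in terms of \<open>op\<close>.\<close>

lemma low_size: "low p xs \<in> supported_on {w. size w \<le> length xs}"
proof (induction p xs rule: low.induct)
  case (1 p)
  then show ?case by (simp add: supported_on_single)
next
  case (2 p q xs)
  show ?case
  proof (cases "p \<in> P \<and> p \<le> q")
    case False
    have A: "low q (sorted_list_of_multiset w) \<in> supported_on {w. size w \<le> length (q # xs)}"
      if "w \<in> {w \<in> keys (low p xs). size w \<le> length xs}" for w
      using 2(3)[OF False that] that
      by (elim supported_on_mono) (auto simp flip: size_mset)
    have "low (b p q) xs \<in> supported_on {w. size w \<le> length (q # xs)}"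
      using 2(4)[OF False] by (rule supported_on_mono) auto
    with A show ?thesis
      by (auto simp: top_def False simp del: One_nat_def
          intro!: supported_on_add supported_on_sum supported_on_scalar_mult supported_on_single)
  qed auto
qed

lemma top_letters: "set_mset w \<subseteq> P \<Longrightarrow> top p w \<in> supported_on {w. set_mset w \<subseteq> P}"
  by (auto simp: top_def intro!: supported_on_single)

lemma low_letters: "set xs \<subseteq> P \<Longrightarrow> low p xs \<in> supported_on {w. set_mset w \<subseteq> P}"
proof (induction p xs rule: low.induct)
  case (1 p)
  then show ?case by (simp add: supported_on_single)
next
  case (2 p q xs)
  show ?case
  proof (cases "p \<in> P \<and> p \<le> q")
    case False
    have w: "set_mset w \<subseteq> P" if "w \<in> keys (low p xs)" for w
      using 2(1)[OF False] 2(5) that by (auto simp: supported_on_def)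
    then have w': "single (add_mset q w) 1 \<in> supported_on {w. set_mset w \<subseteq> P}" if "w \<in> keys (low p xs)" for w
      using 2(5) that by (intro supported_on_single) auto
    have A: "low q (sorted_list_of_multiset w) \<in> supported_on {w. set_mset w \<subseteq> P}"
      if "w \<in> {w \<in> keys (low p xs). size w \<le> length xs}" for w
      using 2(3)[OF False that] that w by auto
    show ?thesis
      unfolding low.simps if_not_P[OF False]
      using A w' 2(4)[OF False] 2(5) top_letters[of "mset xs" "b p q"]
      by (intro supported_on_add supported_on_sum supported_on_scalar_mult)
        auto
  qed auto
qed

lemma low_Cons:
  assumes "\<not> (p \<in> P \<and> p \<le> q)" "q \<in> P" "sorted xs"
  shows "low p (q # xs) = op q (low p xs) + single 0 (c p q) * act1 (b p q) (mset xs)"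
proof -
  have "{w \<in> keys (low p xs). size w \<le> length xs} = keys (low p xs)"
    using low_size[of p xs] by (auto simp: supported_on_def)
  then show ?thesis
    using assms
    by (auto simp: op_def lin_ext_def act1_def top_def sorted_sort_id act1_def[of q, unfolded top_def])
qed

lemma sorted_list_of_add_min:
  "\<forall>x\<in>#w. r \<le> x \<Longrightarrow> sorted_list_of_multiset (add_mset r w) = r # sorted_list_of_multiset w"
  by (simp add: insort_is_Cons)

lemma act1_min: 
  assumes "r \<in> P" "\<forall>x\<in>#w. r \<le> x"
  shows "act1 r w = single (add_mset r w) 1"
proof (cases "sorted_list_of_multiset w")
  case Nil
  with assms show ?thesis by (simp add: act1_def top_def)
next
  case (Cons y ys)
  then have "y \<in># w"
    by (metis list.set_intros(1) set_sorted_list_of_multiset)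
  with Cons assms show ?thesis by (simp add: act1_def top_def)
qed

text \<open>The straightening rule \<open>p r w = r p w + [p, r] w\<close>. It is the recursion of
  \<open>low\<close> with the \<open>top\<close> terms restored: because \<open>r\<close> is least,
  prepending it to \<open>top p w\<close> gives \<open>top p (add_mset r w)\<close>. For
  \<open>p = r\<close> it holds by \<open>c p p = 0\<close>.\<close>

lemma act1_add_min:
  assumes r: "r \<in> P" "\<forall>x\<in>#w. r \<le> x" and p: "p \<in> P \<Longrightarrow> r \<le> p"
  shows "act1 p (add_mset r w) = op r (act1 p w) + single 0 (c p r) * act1 (b p r) w"
proof (cases "p = r")
  case True
  then show ?thesis using r by (simp add: c_self act1_min)
next
  case False
  then have *: "\<not> (p \<in> P \<and> p \<le> r)" using p by auto
  have "op r (top p w) = top p (add_mset r w)"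
    using r p by (auto simp: top_def act1_min add_mset_commute)
  then show ?thesis
    using low_Cons[OF * r(1), of "sorted_list_of_multiset w"] r(2)
    by (simp add: act1_def op_add sorted_list_of_add_min del: low.simps sorted_list_of_multiset_insert)
qed

lemma act1_letters: "set_mset w \<subseteq> P \<Longrightarrow> act1 p w \<in> supported_on {w. set_mset w \<subseteq> P}"
  by (auto simp: act1_def intro!: supported_on_add top_letters low_letters)

lemma op_letters:
  "u \<in> supported_on {w. set_mset w \<subseteq> P} \<Longrightarrow> op p u \<in> supported_on {w. set_mset w \<subseteq> P}"
  unfolding op_def by (erule lin_ext_supported_on) (simp add: act1_letters)

section \<open>The Lie relation, by induction on the length of words\<close>

definition lie_at :: "'a \<Rightarrow> 'a \<Rightarrow> ('a multiset \<Rightarrow>\<^sub>0 'r) \<Rightarrow> bool"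
  where "lie_at p q u \<longleftrightarrow> op p (op q u) - op q (op p u) = single 0 (c p q) * op (b p q) u"

lemma lie_at_sym: "lie_at p q u \<Longrightarrow> lie_at q p u"
  unfolding lie_at_def c_anti[of q p] b_comm[of q p]
  by (simp add: single_uminus algebra_simps)

text \<open>When one of the two operators is the least letter in sight, the relation is the
  straightening rule itself.\<close>

lemma lie_at_min:
  assumes "r \<in> P" "\<forall>x\<in>#w. r \<le> x" "p \<in> P \<Longrightarrow> r \<le> p"
  shows "lie_at p r (single w 1)" "lie_at r p (single w 1)"
proof -
  show "lie_at p r (single w 1)"
    using act1_add_min[OF assms] by (simp add: lie_at_def act1_min assms)
  then show "lie_at r p (single w 1)" by (rule lie_at_sym)
qed

lemma lie_at_0 [simp]: "lie_at p q 0"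
  by (simp add: lie_at_def)

lemma lie_at_add: "lie_at p q u \<Longrightarrow> lie_at p q v \<Longrightarrow> lie_at p q (u + v)"
  by (simp add: lie_at_def op_add algebra_simps)

lemma lie_at_scalar: "lie_at p q u \<Longrightarrow> lie_at p q (single 0 a * u)"
  by (simp add: lie_at_def op_scalar_mult mult.left_commute[of _ "single 0 a"] flip: right_diff_distrib)

lemma lie_at_linear:
  assumes "u \<in> supported_on S" "\<And>w. w \<in> S \<Longrightarrow> lie_at p q (single w 1)"
  shows "lie_at p q u"
proof -
  have "lie_at p q (\<Sum>w\<in>A. single 0 (lookup u w) * single w 1)" if "finite A" "A \<subseteq> keys u" for A
    using that
  proof (induction A rule: finite_induct)
    case empty
    then show ?case by simp
  next
    case (insert x F)
    then have "x \<in> S" using assms(1) by (auto simp: supported_on_def)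
    with insert show ?case by (simp add: lie_at_add lie_at_scalar assms(2))
  qed
  from this[of "keys u"] show ?thesis
    unfolding lin_ext_def [symmetric] by simp
qed

text \<open>Taking for \<open>f\<close> each coefficient of \<open>op x u\<close> as a function of
  \<open>x\<close> turns the abstract identity into one between operators.\<close>

lemma jacobi_op:
  "single 0 (c q r * c p (b q r)) * op (b p (b q r)) u + single 0 (c r p * c q (b r p)) * op (b q (b r p)) u
    + single 0 (c p q * c r (b p q)) * op (b r (b p q)) u = 0"
  using jacobi[of _ _ _ "\<lambda>x. lookup (op x u) _"]
  by (intro poly_mapping_eqI) (simp add: lookup_add)

text \<open>The core of the Poincare-Birkhoff-Witt argument. Split off the least letter
  \<open>r\<close> of \<open>w\<close>. If \<open>p\<close> or \<open>q\<close> belongs to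
  \<open>P\<close> and does not exceed \<open>r\<close>, then \<open>lie_at_min\<close> applies.
  Otherwise \<open>p q w\<close> and \<open>q p w\<close> are both expanded by moving
  \<open>r\<close> to the front, and the discrepancy is the Jacobi sum of \<open>p\<close>,
  \<open>q\<close>, \<open>r\<close> on a shorter word.\<close>

lemma lie_at_monomial: "set_mset w \<subseteq> P \<Longrightarrow> lie_at p q (single w 1)"
proof (induction "size w" arbitrary: w p q rule: less_induct)
  case less
  show ?case
  proof (cases "w = {#}")
    case True
    consider "p \<in> P" "q \<in> P \<Longrightarrow> p \<le> q" | "q \<in> P" "p \<in> P \<Longrightarrow> q \<le> p" | "p \<notin> P" "q \<notin> P"
      by (meson linear)
    then show ?thesis
    proof cases
      case 1
      then show ?thesis
        by (intro lie_at_min) (auto simp: True)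
    next
      case 2
      then show ?thesis
        by (intro lie_at_min) (auto simp: True)
    next
      case 3
      \<comment> \<open>Both letters act on the empty word as scalars, so their commutator is zero
        there. The bracket acts as zero too, because \<open>\<chi>\<close> vanishes on it.\<close>
      then have "single 0 (c p q) * act1 (b p q) {#} = 0"
        using subalgebra[of p q] by (cases "c p q = 0") (auto simp: act1_def top_def)
      with 3 show ?thesis
        by (simp add: True lie_at_def act1_def top_def op_single mult_single mult.commute)
    qed
  next
    case False
    define r where "r = Min_mset w"
    define w' where "w' = w - {#r#}"
    have r: "r \<in># w" "\<forall>x\<in>#w'. r \<le> x"
      using False by (auto simp: r_def w'_def dest: in_diffD)
    have w: "w = add_mset r w'" using r by (simp add: w'_def)
    have rP: "r \<in> P" and w'P: "set_mset w' \<subseteq> P" using less.prems by (auto simp: w)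
    have sz: "size w' < size w" by (simp add: w)
    have known: "lie_at p r (single v 1)"
      if "\<forall>x\<in>#v. r \<le> x" "p \<in> P \<Longrightarrow> r \<le> p" for p v
      using lie_at_min(1)[OF rP that] .
    have IH: "lie_at p q (single v 1)" if "size v < size w" "set_mset v \<subseteq> P" for v p q
      using less.hyps that by blast
    show ?thesis
    proof (cases "(p \<in> P \<and> p \<le> r) \<or> (q \<in> P \<and> q \<le> r)")
      case True
      then consider "p \<in> P" "\<forall>x\<in>#w. p \<le> x" "q \<in> P \<Longrightarrow> p \<le> q" | "q \<in> P" "\<forall>x\<in>#w. q \<le> x" "p \<in> P \<Longrightarrow> q \<le> p"
        using r by (auto simp: w) (metis linear order_trans)+
      then show ?thesis
      proof cases
        case 1
        then show ?thesis by (rule lie_at_min)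
      next
        case 2
        then show ?thesis by (rule lie_at_min)
      qed
    next
      case False
      \<comment> \<open>In words: \<open>p q r w' = r p q w' + [p, r] q w' + [q, r] p w' + [p,
        [q, r]] w'\<close>. The two middle terms are symmetric in \<open>p\<close> and
        \<open>q\<close> and cancel in the commutator.\<close>
      have key: "op p (op q (single w 1)) = op r (op p (op q (single w' 1)))
          + single 0 (c p r) * op (b p r) (op q (single w' 1))
          + single 0 (c q r) * op (b q r) (op p (single w' 1))
          + single 0 (c q r * c p (b q r)) * op (b p (b q r)) (single w' 1)"
        if pq: "\<not> (p \<in> P \<and> p \<le> r)" "\<not> (q \<in> P \<and> q \<le> r)" for p q
      proof -
        have 1: "op q (single w 1) = op r (op q (single w' 1)) + single 0 (c q r) * op (b q r) (single w' 1)"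
          using act1_add_min[OF rP r(2), of q] pq by (auto simp: w)
        \<comment> \<open>In \<open>q w'\<close> the term \<open>top q w'\<close> may be as long as
          \<open>w\<close>, out of reach of the induction hypothesis, but there \<open>r\<close> is
          still the least letter. The remaining words are no longer than \<open>w'\<close>.\<close>
        have "lie_at p r (top q w')"
          using pq r known[of "add_mset q w'" p] by (auto simp: top_def lie_at_0)
        moreover have "lie_at p r (low q (sorted_list_of_multiset w'))"
        proof (rule lie_at_linear)
          show "low q (sorted_list_of_multiset w') \<in> supported_on {v. size v \<le> size w' \<and> set_mset v \<subseteq> P}"
            using low_size[of q "sorted_list_of_multiset w'"] low_letters[of "sorted_list_of_multiset w'" q] w'P
            by (auto simp: supported_on_def simp flip: size_mset)
        qed (use IH sz in auto)
        ultimately have "lie_at p r (op q (single w' 1))"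
          by (simp add: act1_def lie_at_add)
        then have 2: "op p (op r (op q (single w' 1))) = op r (op p (op q (single w' 1)))
            + single 0 (c p r) * op (b p r) (op q (single w' 1))"
          by (simp add: lie_at_def algebra_simps)
        have "lie_at p (b q r) (single w' 1)" using IH sz w'P by blast
        then have 3: "op p (op (b q r) (single w' 1)) = op (b q r) (op p (single w' 1))
            + single 0 (c p (b q r)) * op (b p (b q r)) (single w' 1)"
          by (simp add: lie_at_def algebra_simps)
        show ?thesis
          unfolding 1 op_add op_scalar_mult 2 3
          by (simp add: algebra_simps mult_single flip: mult.assoc)
      qed
      have 4: "op p (op q (single w' 1)) = op q (op p (single w' 1)) + single 0 (c p q) * op (b p q) (single w' 1)"
        using IH[OF sz w'P, of p q] by (simp add: lie_at_def algebra_simps)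
      have "lie_at r (b p q) (single w' 1)" using IH sz w'P by blast
      then have 5: "op r (op (b p q) (single w' 1)) = op (b p q) (single w 1)
            + single 0 (c r (b p q)) * op (b r (b p q)) (single w' 1)"
        using act1_min[OF rP r(2)] by (simp add: lie_at_def algebra_simps flip: w)
      have 6: "single 0 (c p r * c q (b p r)) * op (b q (b p r)) (single w' 1) =
         - (single 0 (c r p * c q (b r p)) * op (b q (b r p)) (single w' 1))"
        by (simp add: c_anti[of p r] b_comm[of p r] single_uminus)
      have "op p (op q (single w 1)) - op q (op p (single w 1)) = 
         single 0 (c p q) * op (b p q) (single w 1)
         + (single 0 (c q r * c p (b q r)) * op (b p (b q r)) (single w' 1)
            + single 0 (c r p * c q (b r p)) * op (b q (b r p)) (single w' 1)
            + single 0 (c p q * c r (b p q)) * op (b r (b p q)) (single w' 1))"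
        using False
        unfolding key[of p q, simplified] de_Morgan_disj
        by (simp add: key 4 op_add op_scalar_mult 5 6 algebra_simps mult_single del: op_monomial flip: mult.assoc)
      then show ?thesis
        by (simp add: lie_at_def jacobi_op del: op_monomial)
    qed
  qed
qed

theorem op_bracket:
  assumes "u \<in> supported_on {w. set_mset w \<subseteq> P}"
  shows "op p (op q u) - op q (op p u) = single 0 (c p q) * op (b p q) u"
  using lie_at_linear[OF assms] lie_at_monomial by (auto simp: lie_at_def)

end

section \<open>Leading terms\<close>

abbreviation shorter :: "nat \<Rightarrow> ('a multiset \<Rightarrow>\<^sub>0 'r::zero) set"
  where "shorter n \<equiv> supported_on {w. size w < n}"

lemma shorter_0: "u \<in> shorter 0 \<Longrightarrow> u = 0"
  by (auto intro!: poly_mapping_eqI dest: supported_onD)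

lemma shorter_mono: "u \<in> shorter m \<Longrightarrow> m \<le> n \<Longrightarrow> u \<in> shorter n"
  by (erule supported_on_mono) auto

lemma supported_on_sum_mset:
  "(\<And>x. x \<in># M \<Longrightarrow> f x \<in> supported_on S) \<Longrightarrow> (\<Sum>x\<in>#M. f x) \<in> supported_on S"
  by (induction M) (auto intro: supported_on_add)

lemma add_mset_diff_single: "s \<in># w \<Longrightarrow> add_mset r w - {#s#} = add_mset r (w - {#s#})"
  by (simp add: diff_union_single_conv)

context induced_module
begin

lemma act1_P_leading: "p \<in> P \<Longrightarrow> act1 p w - single (add_mset p w) 1 \<in> shorter (Suc (size w))"
  using low_size[of p "sorted_list_of_multiset w"]
  by (simp add: act1_def top_def less_Suc_eq_le flip: size_mset)

lemma act1_not_P_size: "p \<notin> P \<Longrightarrow> act1 p w \<in> shorter (Suc (size w))"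
  using low_size[of p "sorted_list_of_multiset w"]
  by (simp add: act1_def top_def less_Suc_eq_le flip: size_mset)

lemma act1_size: "act1 p w \<in> shorter (Suc (Suc (size w)))"
proof (cases "p \<in> P")
  case True
  have "(act1 p w - single (add_mset p w) 1) + single (add_mset p w) 1 \<in> shorter (Suc (Suc (size w)))"
    by (intro supported_on_add supported_on_single shorter_mono[OF act1_P_leading[OF True]]) auto
  then show ?thesis by simp
qed (auto intro: shorter_mono act1_not_P_size)

lemma op_shorter: "u \<in> shorter n \<Longrightarrow> op p u \<in> shorter (Suc n)"
  unfolding op_def by (erule lin_ext_supported_on) (auto intro: shorter_mono[OF act1_size])

text \<open>Up to shorter words a letter of \<open>P\<close> acts as in the commutative polynomial
  ring, because every reordering costs a letter.\<close>

lemma op_shorter_leading: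
  assumes "u \<in> shorter n" "p \<in> P"
  shows "op p u - single {#p#} 1 * u \<in> shorter n"
proof -
  have "single {#p#} 1 * u = lin_ext (\<lambda>w. single (add_mset p w) 1) u"
    using lin_ext_mult_monomial[of "single {#p#} 1" "\<lambda>w. single w 1" u] by (simp add: mult_single)
  then have "op p u - single {#p#} 1 * u = lin_ext (\<lambda>w. act1 p w - single (add_mset p w) 1) u"
    by (simp add: op_def lin_ext_fun_diff)
  also have "\<dots> \<in> shorter n"
    by (rule lin_ext_supported_on[OF assms(1)])
      (auto intro: shorter_mono[OF act1_P_leading[OF assms(2)]])
  finally show ?thesis .
qed

text \<open>The part of the commutator of \<open>p\<close> with \<open>w\<close> that keeps the
  length: a letter \<open>s\<close> is exchanged for its bracket with \<open>p\<close>.\<close>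

definition replace :: "'a \<Rightarrow> 'a multiset \<Rightarrow> 'a multiset \<Rightarrow>\<^sub>0 'r"
  where "replace p w = (\<Sum>s\<in>#w. if b p s \<in> P then single (add_mset (b p s) (w - {#s#})) (c p s) else 0)"

text \<open>The part that loses exactly one letter: the bracket of \<open>p\<close> with
  \<open>s\<close> is moved to the right end of the word, where it becomes the scalar
  \<open>\<chi> (b p s)\<close>.\<close>

definition contract :: "'a \<Rightarrow> 'a multiset \<Rightarrow> 'a multiset \<Rightarrow>\<^sub>0 'r"
  where "contract p w = (\<Sum>s\<in>#w. single (w - {#s#}) (c p s * \<chi> (b p s)))"

lemma replace_add_mset:
  "replace p (add_mset r w) = single {#r#} 1 * replace p w
    + (if b p r \<in> P then single (add_mset (b p r) w) (c p r) else 0)"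
proof -
  have "(\<Sum>s\<in>#w. if b p s \<in> P then single (add_mset (b p s) (add_mset r w - {#s#})) (c p s) else 0)
      = single {#r#} 1 * replace p w"
    by (auto simp: replace_def sum_mset_distrib_left mult_single add_mset_diff_single add_mset_commute
        intro!: arg_cong[where f = sum_mset] image_mset_cong)
  then show ?thesis by (simp add: replace_def)
qed

lemma contract_add_mset:
  "contract p (add_mset r w) = single {#r#} 1 * contract p w + single w (c p r * \<chi> (b p r))"
proof -
  have "(\<Sum>s\<in>#w. single (add_mset r w - {#s#}) (c p s * \<chi> (b p s))) = single {#r#} 1 * contract p w"
    by (auto simp: contract_def sum_mset_distrib_left mult_single add_mset_diff_single
        intro!: arg_cong[where f = sum_mset] image_mset_cong)
  then show ?thesis by (simp add: contract_def)
qed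

lemma replace_size: "replace p w \<in> shorter (Suc (size w))"
  by (auto simp: replace_def size_Diff_singleton intro!: supported_on_sum_mset supported_on_single)
    (metis Suc_pred less_Suc_eq nonempty_has_size empty_iff set_mset_empty)

lemma contract_size: "contract p w \<in> shorter (size w)"
  by (auto simp: contract_def intro!: supported_on_sum_mset supported_on_single size_Diff1_less)

text \<open>Moving \<open>p\<close> to the right end of \<open>w\<close> leaves
  \<open>\<chi> p\<close> there and one commutator for each letter passed. A commutator in
  \<open>P\<close> keeps the length; sorting it into place, or a commutator outside of
  \<open>P\<close>, only adds shorter words.\<close>

theorem act1_leading:
  assumes "p \<notin> P" "set_mset w \<subseteq> P"
  shows "act1 p w - single w (\<chi> p) - replace p w \<in> shorter (size w)"
  using assms(2)
proof (induction w rule: multiset_induct_min)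
  case empty
  then show ?case using assms(1) by (simp add: act1_def top_def replace_def)
next
  case (add r w)
  then have r: "r \<in> P" "\<forall>x\<in>#w. r \<le> x" and w: "set_mset w \<subseteq> P" by auto
  define err where "err = act1 p w - single w (\<chi> p) - replace p w"
  have err: "err \<in> shorter (size w)" using add w by (simp add: err_def)
  have split: "act1 p w = single w (\<chi> p) + replace p w + err" by (simp add: err_def)
  define b' where "b' = single 0 (c p r) * act1 (b p r) w
    - (if b p r \<in> P then single (add_mset (b p r) w) (c p r) else 0)"
  have b': "b' \<in> shorter (Suc (size w))"
  proof (cases "b p r \<in> P")
    case True
    then have "b' = single 0 (c p r) * (act1 (b p r) w - single (add_mset (b p r) w) 1)"
      by (simp add: b'_def right_diff_distrib mult_single)
    then show ?thesis by (simp add: supported_on_scalar_mult act1_P_leading True)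
  qed (simp add: b'_def supported_on_scalar_mult act1_not_P_size)
  have "act1 p (add_mset r w) - single (add_mset r w) (\<chi> p) - replace p (add_mset r w) =
     op r err + (op r (replace p w) - single {#r#} 1 * replace p w) + b'"
    using act1_add_min[OF r, of p] assms(1)
    by (simp add: split op_add op_single act1_min[OF r] replace_add_mset b'_def mult_single
        algebra_simps)
  also have "\<dots> \<in> shorter (Suc (size w))"
    using op_shorter[OF err, of r] op_shorter_leading[OF replace_size r(1), of p w] b'
    by (intro supported_on_add)
  finally show ?case by simp
qed

text \<open>On words in \<open>S\<close> the leading term of \<open>act1_leading\<close> vanishes; this is the next one.\<close>

theorem act1_contract:
  assumes "Q \<inter> P = {}" "S \<subseteq> P" "\<And>p s. p \<in> Q \<Longrightarrow> s \<in> S \<Longrightarrow> b p s \<in> Q"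
  assumes "p \<in> Q" "set_mset w \<subseteq> S"
  shows "act1 p w - single w (\<chi> p) - contract p w \<in> shorter (size w - 1)"
  using assms(4,5)
proof (induction w arbitrary: p rule: multiset_induct_min)
  case empty
  then show ?case using assms(1) by (auto simp: act1_def top_def contract_def)
next
  case (add r w)
  then have r: "r \<in> P" "\<forall>x\<in>#w. r \<le> x" and rS: "r \<in> S" and w: "set_mset w \<subseteq> S" using assms(2) by auto
  define err where "err p = act1 p w - single w (\<chi> p) - contract p w" for p
  have err: "err p \<in> shorter (size w - 1)" if "p \<in> Q" for p using add that w by (simp add: err_def)
  have split: "act1 p w = single w (\<chi> p) + contract p w + err p" for p by (simp add: err_def)
  have bQ: "b p r \<in> Q" using assms(3) add.prems(1) rS by blast
  have pP: "p \<notin> P" using add.prems(1) assms(1) by auto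
  \<comment> \<open>The error bound is \<open>size w - 1\<close> with truncated subtraction. For the
    empty word it still says that the error is zero, so that applying \<open>r\<close> cannot make
    it too long.\<close>
  have "op r (err p) \<in> shorter (size w)"
  proof (cases "size w = 0")
    case True
    then show ?thesis using shorter_0[of "err p"] err[OF add.prems(1)] by simp
  next
    case False
    then show ?thesis using op_shorter[OF err[OF add.prems(1)], of r] by (simp add: nonempty_has_size)
  qed
  moreover have "act1 p (add_mset r w) - single (add_mset r w) (\<chi> p) - contract p (add_mset r w) =
     op r (err p) + (op r (contract p w) - single {#r#} 1 * contract p w)
       + single 0 (c p r) * (contract (b p r) w + err (b p r))"
    using act1_add_min[OF r, of p] pP
    by (simp add: split[of p] split[of "b p r"] op_add op_single act1_min[OF r] contract_add_mset
        mult_single algebra_simps)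
  moreover have "\<dots> \<in> shorter (size w)"
    using op_shorter_leading[OF contract_size r(1), of p w] calculation(1)
      contract_size[of "b p r" w] shorter_mono[OF err[OF bQ], of "size w"]
    by (intro supported_on_add supported_on_scalar_mult) auto
  ultimately show ?case by simp
qed

end

section \<open>The universal Whittaker module\<close>

definition grade :: "int \<times> nat \<Rightarrow> int"
  where "grade p = fst p + int (snd p) - 1"

definition coeff_int :: "int \<times> nat \<Rightarrow> int \<times> nat \<Rightarrow> int"
  where "coeff_int p q = (fst q - 1) * int (snd p) - (fst p - 1) * int (snd q)"

definition coeff_poly :: "int \<times> nat \<Rightarrow> int \<times> nat \<Rightarrow> complex poly"
  where "coeff_poly p q = of_int (coeff_int p q)"

definition target :: "int \<times> nat \<Rightarrow> int \<times> nat \<Rightarrow> int \<times> nat"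
  where "target p q = (fst p + fst q, snd p + snd q - 1)"

text \<open>The element \<open>(1, 0)\<close> has degree 0 but is central. It is put into the
  subalgebra that carries the character, and thus turns into a coefficient instead of a
  letter.\<close>

definition neg_letters :: "(int \<times> nat) set"
  where "neg_letters = {p. grade p \<le> 0} - {(1, 0)}"

definition central_char :: "(B \<Rightarrow> complex) \<Rightarrow> int \<times> nat \<Rightarrow> complex poly"
  where "central_char \<phi> p = (if p = (1, 0) then [:0, 1:] else [:\<phi> (xB p):])"

lemma xB_bracket_conv: "xB_bracket p q = B_scale (of_int (coeff_int p q)) (xB (target p q))"
  by (simp add: xB_bracket_def coeff_int_def target_def split: prod.splits)

lemma grade_target: "coeff_int p q \<noteq> 0 \<Longrightarrow> grade (target p q) = grade p + grade q"
  by (cases "snd p + snd q = 0") (auto simp: grade_def target_def coeff_int_def)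

text \<open>The truncated subtraction in \<open>target q r\<close> differs from the integer one only
  if both second indices are 0, and then the first factor vanishes. Hence the Jacobi identity can be
  checked in the integers.\<close>

lemma coeff_target:
  "coeff_int q r * coeff_int p (target q r) =
     coeff_int q r * ((fst q + fst r - 1) * int (snd p) - (fst p - 1) * (int (snd q) + int (snd r) - 1))"
  by (cases "snd q + snd r = 0") (auto simp: target_def coeff_int_def of_nat_diff)

lemma target_target:
  "coeff_int q r \<noteq> 0 \<Longrightarrow> target p (target q r) = (fst p + fst q + fst r, snd p + snd q + snd r - 2)"
  by (cases "snd q + snd r = 0") (auto simp: target_def coeff_int_def)

text \<open>In degree at least 2 every basis element is a bracket inside \<open>nil_part\<close>:
  \<open>[x_(a-2,i+1), x_(2,0)]\<close> is \<open>i + 1\<close> times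
  \<open>x_(a,i)\<close>.\<close>

lemma lie_character_vanishes:
  assumes "lie_character \<phi>" "grade p \<ge> 2"
  shows "\<phi> (xB p) = 0"
proof -
  obtain a i where p: "p = (a, i)" by (cases p)
  have mem: "xB q \<in> nil_part" if "grade q \<ge> 1" for q
    using that by (cases q) (auto simp: nil_part_def grade_def intro!: B.span_base)
  have q: "xB (a - 2, Suc i) \<in> nil_part" "xB (2, 0) \<in> nil_part" "xB p \<in> nil_part"
    using assms(2) by (auto intro!: mem simp: p grade_def)
  have "B_bracket (xB (a - 2, Suc i)) (xB (2, 0)) = B_scale (of_nat (Suc i)) (xB p)"
    by (simp add: B_bracket_xB xB_bracket_def p)
  moreover have "\<phi> (B_bracket (xB (a - 2, Suc i)) (xB (2, 0))) = 0"
    using assms(1) q unfolding lie_character_def by blast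
  moreover have "\<phi> (B_scale (of_nat (Suc i)) (xB p)) = of_nat (Suc i) * \<phi> (xB p)"
    using assms(1) q unfolding lie_character_def by blast
  ultimately have "of_nat (Suc i) * \<phi> (xB p) = 0" by simp
  then show ?thesis by (simp del: of_nat_Suc)
qed

lemma induced_module_B:
  assumes "lie_character \<phi>"
  shows "induced_module coeff_poly target neg_letters (central_char \<phi>)"
proof
  fix p q r and f :: "int \<times> nat \<Rightarrow> complex poly"
  show "coeff_poly p p = 0" "coeff_poly q p = - coeff_poly p q" "target q p = target p q"
    by (auto simp: coeff_poly_def coeff_int_def target_def add.commute algebra_simps simp flip: of_int_minus)
  define t where "t = f (fst p + fst q + fst r, snd p + snd q + snd r - 2)"
  have *: "coeff_poly q r * coeff_poly p (target q r) * f (target p (target q r)) = 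
      of_int (coeff_int q r * ((fst q + fst r - 1) * int (snd p) - (fst p - 1) * (int (snd q) + int (snd r) - 1)))
        * f (fst p + fst q + fst r, snd p + snd q + snd r - 2)" for p q r
    unfolding coeff_target [symmetric]
    using target_target[of q r p] by (cases "coeff_int q r = 0") (auto simp: coeff_poly_def)
  have t: "f (fst q + fst r + fst p, snd q + snd r + snd p - 2) = t"
    "f (fst r + fst p + fst q, snd r + snd p + snd q - 2) = t"
    "f (fst p + fst q + fst r, snd p + snd q + snd r - 2) = t"
    by (simp_all add: t_def add_ac)
  show "coeff_poly q r * coeff_poly p (target q r) * f (target p (target q r)) +
       coeff_poly r p * coeff_poly q (target r p) * f (target q (target r p)) +
       coeff_poly p q * coeff_poly r (target p q) * f (target r (target p q)) = 0"
    unfolding * t distrib_right [symmetric] of_int_add [symmetric]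
    by (simp add: coeff_int_def algebra_simps)
  show "target p q \<notin> neg_letters \<and> central_char \<phi> (target p q) = 0"
    if "p \<notin> neg_letters" "q \<notin> neg_letters" "coeff_poly p q \<noteq> 0"
  proof -
    have c: "coeff_int p q \<noteq> 0" using that(3) by (auto simp: coeff_poly_def)
    \<comment> \<open>A nonzero coefficient excludes the central element. So both degrees are at
      least 1, and the bracket has degree at least 2, where \<open>\<phi>\<close> vanishes.\<close>
    then have "p \<noteq> (1, 0)" "q \<noteq> (1, 0)" by (auto simp: coeff_int_def)
    with that have "grade (target p q) \<ge> 2"
      by (simp add: grade_target[OF c] neg_letters_def)
    then show ?thesis
      using lie_character_vanishes[OF assms]
      by (auto simp: neg_letters_def central_char_def grade_def)
  qed
qed

section \<open>Linear algebra of the Hankel condition\<close>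

lemma sum_apply: "(\<Sum>i\<in>A. F i) m = (\<Sum>i\<in>A. F i m)"
  by (induction A rule: infinite_finite_induct) auto

text \<open>The rank is the dimension of the set of columns. Its value \<open>n + 1\<close> first
  shows that no two columns coincide, then that a maximal independent subset is the whole set; only
  then can a relation be indexed by the column number.\<close>

lemma good_character_independent:
  assumes "good_character \<phi>" "n \<ge> 1" "s \<ge> 1"
    and rel: "\<And>m. m \<ge> 1 \<Longrightarrow> (\<Sum>j\<le>n. c j * \<phi> (xB (2 - int (m + j + s - 1), m + j + s - 1))) = 0"
    and "j \<le> n"
  shows "c j = 0"
proof -
  define col where "col j m = (if m \<in> {1..} then H_matrix \<phi> s m j else 0)" for j m
  let ?S = "col ` {0..n}"
  have dim: "fun_space.dim ?S = n + 1"
    using assms(1-3) by (auto simp: good_character_def matrix_rank_def col_def[abs_def])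
  obtain Bs where Bs: "Bs \<subseteq> ?S" "\<not> fun_space.dependent Bs" "card Bs = fun_space.dim ?S"
    by (rule fun_space.basis_exists[of ?S]) blast
  have "card ?S \<le> n + 1" using card_image_le[of "{0..n}" col] by simp
  moreover have "card Bs \<le> card ?S" by (rule card_mono[OF _ Bs(1)]) simp
  ultimately have card: "card ?S = n + 1" using Bs(3) dim by simp
  then have "Bs = ?S"
    by (intro card_subset_eq) (use Bs dim in auto)
  then have ind: "\<not> fun_space.dependent ?S" using Bs(2) by simp
  have inj: "inj_on col {0..n}"
    by (rule eq_card_imp_inj_on) (simp_all only: card finite_atLeastAtMost card_atLeastAtMost)
  have "(\<Sum>v\<in>?S. (\<lambda>m. c (the_inv_into {0..n} col v) * v m)) = 0"
  proof
    fix m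
    have "(\<Sum>v\<in>?S. (\<lambda>m. c (the_inv_into {0..n} col v) * v m)) m = (\<Sum>j\<in>{0..n}. c j * col j m)"
      by (simp add: sum.reindex[OF inj] the_inv_into_f_f[OF inj] sum_apply)
    also have "\<dots> = (if m \<ge> 1 then (\<Sum>j\<le>n. c j * \<phi> (xB (2 - int (m + j + s - 1), m + j + s - 1))) else 0)"
      by (auto simp: col_def H_matrix_def Let_def atMost_atLeast0)
    also have "\<dots> = 0" using rel by auto
    finally show "(\<Sum>v\<in>?S. (\<lambda>m. c (the_inv_into {0..n} col v) * v m)) m = 0 m" by simp
  qed
  then have "c (the_inv_into {0..n} col (col j)) = 0"
    using fun_space.independentD[OF ind _ subset_refl, of "\<lambda>v. c (the_inv_into {0..n} col v)" "col j"]
      assms(5) by simp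
  then show ?thesis using the_inv_into_f_f[OF inj] assms(5) by simp
qed

lemma smult_sum_right: "smult a (\<Sum>i\<in>A. f i) = (\<Sum>i\<in>A. smult a (f i))"
  by (induction A rule: infinite_finite_induct) (auto simp: smult_add_right)

text \<open>Independent functions on a finite index set are separated by finitely many arguments
  \<open>m\<close>, so each \<open>f i\<close> is a complex combination of the given sums. The proof
  is Gaussian elimination, one index at a time.\<close>

lemma eliminate_modulo_subspace:
  fixes g :: "'i \<Rightarrow> nat \<Rightarrow> complex" and f :: "'i \<Rightarrow> complex poly"
  assumes "finite A"
    and I: "0 \<in> I" "\<And>x y. x \<in> I \<Longrightarrow> y \<in> I \<Longrightarrow> x + y \<in> I" "\<And>a x. x \<in> I \<Longrightarrow> smult a x \<in> I"
    and "\<And>c i. (\<And>m. (\<Sum>i\<in>A. c i * g i m) = 0) \<Longrightarrow> i \<in> A \<Longrightarrow> c i = 0"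
    and "\<And>m. (\<Sum>i\<in>A. smult (g i m) (f i)) \<in> I"
    and "i \<in> A"
  shows "f i \<in> I"
  using assms(1,5-7)
proof (induction A arbitrary: g i rule: finite_induct)
  case (insert x F)
  have diff: "u - v \<in> I" if "u \<in> I" "v \<in> I" for u v
    using I(2)[OF that(1) I(3)[OF that(2), of "-1"]] by simp
  have "\<exists>m. g x m \<noteq> 0"
  proof (rule ccontr)
    assume "\<nexists>m. g x m \<noteq> 0"
    then have "(\<Sum>i\<in>insert x F. (if i = x then 1 else 0) * g i m) = 0" for m
      using insert(1,2) by (auto intro!: sum.neutral)
    from insert.prems(1)[OF this, of x] show False by simp
  qed
  then obtain m0 where m0: "g x m0 \<noteq> 0" by blast
  \<comment> \<open>Row \<open>m\<close> minus the multiple of the pivot row \<open>m0\<close> that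
    makes the entry at \<open>x\<close> zero.\<close>
  define g' where "g' i m = g i m - g i m0 / g x m0 * g x m" for i m
  have F: "f i \<in> I" if "i \<in> F" for i
  proof (rule insert.IH[of g'])
    fix c i assume c: "\<And>m. (\<Sum>i\<in>F. c i * g' i m) = 0" and i: "i \<in> F"
    \<comment> \<open>A relation among the reduced functions becomes one among the original ones;
      the coefficient at \<open>x\<close> collects the subtracted multiples of
      \<open>g x\<close>.\<close>
    define c' where "c' i = (if i = x then - (\<Sum>i\<in>F. c i * g i m0) / g x m0 else c i)" for i
    have "(\<Sum>i\<in>insert x F. c' i * g i m) = (\<Sum>i\<in>F. c i * g' i m)" for m
    proof -
      have "(\<Sum>i\<in>F. c' i * g i m) = (\<Sum>i\<in>F. c i * g i m)"
        using insert(2) by (intro sum.cong) (auto simp: c'_def)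
      then show ?thesis
        using insert(1,2)
        by (simp add: c'_def g'_def sum_distrib_left sum_distrib_right sum_divide_distrib algebra_simps sum_subtractf)
    qed
    then have "(\<Sum>i\<in>insert x F. c' i * g i m) = 0" for m using c by simp
    from insert.prems(1)[OF this, of i] i insert(2) show "c i = 0" by (simp add: c'_def split: if_splits)
  next
    fix m
    have "(\<Sum>i\<in>F. smult (g' i m) (f i)) = (\<Sum>i\<in>insert x F. smult (g i m) (f i))
        - smult (g x m / g x m0) (\<Sum>i\<in>insert x F. smult (g i m0) (f i))"
      using insert(1,2) m0
      by (simp add: g'_def smult_diff_left sum_subtractf smult_add_right smult_sum_right mult.commute)
    also have "\<dots> \<in> I" by (intro diff I(3) insert.prems)
    finally show "(\<Sum>i\<in>F. smult (g' i m) (f i)) \<in> I" .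
  qed (use that in auto)
  show ?case
  proof (cases "i = x")
    case True
    have S: "(\<Sum>i\<in>F. smult (g i m0) (f i)) \<in> I"
      using insert(1) F by (induction F rule: finite_induct) (auto intro: I)
    have "f x = smult (1 / g x m0) ((\<Sum>i\<in>insert x F. smult (g i m0) (f i)) - (\<Sum>i\<in>F. smult (g i m0) (f i)))"
      using insert(1,2) m0 by simp
    also have "\<dots> \<in> I" by (intro diff I(3) insert.prems S)
    finally show ?thesis using True by simp
  qed (use insert.prems F in auto)
qed auto

lemma lookup_lin_ext:
  "lookup (lin_ext f u) w = (\<Sum>k\<in>keys u. lookup u k * lookup (f k) w)"
  by (simp add: lin_ext_def lookup_sum)

lemma lookup_sum_mset: "lookup (\<Sum>s\<in>#M. f s) w = (\<Sum>s\<in>#M. lookup (f s) w)"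
  by (induction M) (auto simp: lookup_add)

lemma grade_target_pos: "0 < snd p \<Longrightarrow> grade (target p q) = grade p + grade q"
  by (simp add: grade_def target_def)

abbreviation neg_words :: "(int \<times> nat) multiset set"
  where "neg_words \<equiv> {w. set_mset w \<subseteq> neg_letters}"

section \<open>The centre and the positive part acting on words\<close>

locale whittaker_character =
  fixes \<phi> :: "B \<Rightarrow> complex"
  assumes good: "good_character \<phi>"
begin

sublocale induced_module coeff_poly target neg_letters "central_char \<phi>"
  using good by (intro induced_module_B) (simp add: good_character_def)

abbreviation \<chi> where "\<chi> \<equiv> central_char \<phi>"

lemma act1_center: "set_mset w \<subseteq> neg_letters \<Longrightarrow> act1 (1, 0) w = single w [:0, 1:]"
proof (induction w rule: multiset_induct_min)
  case empty
  have "(1, 0) \<notin> neg_letters" "\<chi> (1, 0) = [:0, 1:]"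
    by (simp_all add: neg_letters_def central_char_def)
  then show ?case by (simp add: act1_def top_def)
next
  case (add r w)
  have "coeff_poly (1, 0) r = 0" "(1, 0) \<notin> neg_letters"
    by (simp_all add: coeff_poly_def coeff_int_def neg_letters_def)
  with add have "act1 (1, 0) (add_mset r w) = op r (act1 (1, 0) w)"
    using act1_add_min[of r w "(1, 0)"] by simp
  with add show ?case by (simp add: op_single act1_min mult_single)
qed

lemma op_center:
  assumes "u \<in> supported_on neg_words"
  shows "op (1, 0) u = single 0 [:0, 1:] * u"
proof -
  have "op (1, 0) u = lin_ext (\<lambda>w. single 0 [:0, 1:] * single w 1) u"
    unfolding op_def by (rule lin_ext_cong[OF assms]) (simp add: act1_center mult_single)
  then show ?thesis using lin_ext_mult_monomial[of _ "\<lambda>w. single w 1" u] by simp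
qed

text \<open>For \<open>p\<close> outside of \<open>neg_letters\<close> the operator
  \<open>p - \<chi> p\<close> kills the empty word, so on longer words only commutators
  survive.\<close>

definition shift :: "int \<times> nat \<Rightarrow> ((int \<times> nat) multiset \<Rightarrow>\<^sub>0 complex poly) \<Rightarrow> (int \<times> nat) multiset \<Rightarrow>\<^sub>0 complex poly"
  where "shift p u = op p u - single 0 (\<chi> p) * u"

lemma shift_lin_ext: "shift p u = lin_ext (\<lambda>w. act1 p w - single w (\<chi> p)) u"
  using lin_ext_mult_monomial[of "single 0 (\<chi> p)" "\<lambda>w. single w 1" u]
  by (simp add: shift_def op_def lin_ext_fun_diff mult_single)

lemma lookup_replace:
  "lookup (replace p w) v = (\<Sum>s\<in>#w. if target p s \<in> neg_letters \<and> add_mset (target p s) (w - {#s#}) = v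
     then coeff_poly p s else 0)"
  unfolding replace_def lookup_sum_mset
  by (intro arg_cong[where f = sum_mset] image_mset_cong) (auto simp: lookup_single when_def)

lemma lookup_contract:
  "lookup (contract p w) v = (\<Sum>s\<in>#w. if w - {#s#} = v then coeff_poly p s * \<chi> (target p s) else 0)"
  unfolding contract_def lookup_sum_mset
  by (intro arg_cong[where f = sum_mset] image_mset_cong) (auto simp: lookup_single when_def)

lemma shift_leading:
  assumes "p \<notin> neg_letters" "w \<in> neg_words" "size w \<le> size v"
  shows "lookup (act1 p w - single w (\<chi> p)) v = lookup (replace p w) v"
  using supported_onD[OF act1_leading[OF assms(1), of w], of v] assms
  by (simp add: lookup_minus)

lemma shift_larger:
  assumes "p \<notin> neg_letters" "w \<in> neg_words" "size w < size v"
  shows "lookup (act1 p w - single w (\<chi> p)) v = 0"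
  using shift_leading[OF assms(1,2), of v] supported_onD[OF replace_size[of p w], of v] assms(3)
  by simp

end

section \<open>Invariant subspaces and their ideal of scalars\<close>

locale invariant_subspace = whittaker_character +
  fixes K :: "((int \<times> nat) multiset \<Rightarrow>\<^sub>0 complex poly) set"
  assumes K_neg: "K \<subseteq> supported_on neg_words"
    and K_0: "0 \<in> K"
    and K_add: "u \<in> K \<Longrightarrow> v \<in> K \<Longrightarrow> u + v \<in> K"
    and K_scale: "u \<in> K \<Longrightarrow> single 0 [:a:] * u \<in> K"
    and K_op: "u \<in> K \<Longrightarrow> op p u \<in> K"
begin

definition scalars :: "complex poly set"
  where "scalars = {f. single 0 f \<in> K}"

text \<open>\<open>K\<close> is assumed to be closed under complex scalars only. The variable
  \<open>X\<close> comes from the action of the central letter \<open>(1, 0)\<close>, all other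
  polynomials by induction.\<close>

lemma K_scalar_mult: "u \<in> K \<Longrightarrow> single 0 f * u \<in> K"
proof (induction f arbitrary: u)
  case 0
  then show ?case by (simp add: K_0)
next
  case (pCons a f)
  have "single 0 (pCons a f) * u = single 0 [:a:] * u + single 0 f * (single 0 [:0, 1:] * u)"
    by (simp add: mult_single distrib_right[symmetric] single_add[symmetric] mult.assoc[symmetric] del: mult.assoc)
  also have "\<dots> = single 0 [:a:] * u + single 0 f * op (1, 0) u"
    using op_center[of u] pCons.prems K_neg by auto
  also have "\<dots> \<in> K" by (intro K_add K_scale pCons K_op)
  finally show ?case .
qed

lemma K_diff: "u \<in> K \<Longrightarrow> v \<in> K \<Longrightarrow> u - v \<in> K"
  using K_add[of u "- v"] K_scalar_mult[of v "-1"] by (simp add: single_uminus)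

lemma K_sum: "(\<And>i. i \<in> A \<Longrightarrow> f i \<in> K) \<Longrightarrow> sum f A \<in> K"
  by (induction A rule: infinite_finite_induct) (auto simp: K_0 K_add)

lemma K_shift: "u \<in> K \<Longrightarrow> shift p u \<in> K"
  by (simp add: shift_def K_diff K_op K_scalar_mult)

lemma scalars_0: "0 \<in> scalars"
  and scalars_add: "f \<in> scalars \<Longrightarrow> g \<in> scalars \<Longrightarrow> f + g \<in> scalars"
  and scalars_mult: "f \<in> scalars \<Longrightarrow> g * f \<in> scalars"
  using K_scalar_mult[of "single 0 f" g]
  by (auto simp: scalars_def K_0 K_add single_add mult_single)

lemma scalars_smult: "f \<in> scalars \<Longrightarrow> smult a f \<in> scalars"
  using scalars_mult[of f "[:a:]"] by simp

lemma scalars_cancel: "smult a f \<in> scalars \<Longrightarrow> a \<noteq> 0 \<Longrightarrow> f \<in> scalars"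
  using scalars_smult[of "smult a f" "inverse a"] by simp

text \<open>The letters of \<open>w\<close> are applied to \<open>single 0 f\<close> from the
  largest down to the smallest, so no straightening occurs.\<close>

lemma K_monomial: "f \<in> scalars \<Longrightarrow> set_mset w \<subseteq> neg_letters \<Longrightarrow> single w f \<in> K"
proof (induction w rule: multiset_induct_min)
  case empty
  then show ?case by (simp add: scalars_def)
next
  case (add r w)
  then have "op r (single w f) \<in> K" by (intro K_op) auto
  with add show ?case by (simp add: op_single act1_min mult_single)
qed

text \<open>The substitute for a quotient of the coefficient ring: what remains of \<open>u\<close>
  has only coefficients that are nonzero modulo the ideal.\<close>

lemma reduce_modulo_scalars:
  assumes "u \<in> K"
  obtains u' where "u' \<in> K" "\<And>w. lookup u' w = (if lookup u w \<in> scalars then 0 else lookup u w)"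
proof
  let ?A = "{w \<in> keys u. lookup u w \<in> scalars}"
  let ?u = "u - (\<Sum>w\<in>?A. single w (lookup u w))"
  show "?u \<in> K"
    using assms K_neg by (intro K_diff K_sum K_monomial) (auto simp: supported_on_def)
  show "lookup ?u w = (if lookup u w \<in> scalars then 0 else lookup u w)" for w
    by (auto simp: lookup_minus lookup_sum lookup_single when_def in_keys_iff)
qed

lemma letters_bounded: "\<exists>n\<ge>1. \<forall>w\<in>keys u. \<forall>s\<in>#w. snd s \<le> (n::nat)"
  for u :: "('b \<times> nat) multiset \<Rightarrow>\<^sub>0 'c::zero"
proof -
  have "finite (snd ` (\<Union>w\<in>keys u. set_mset w))" by simp
  then obtain n where "\<forall>x\<in>snd ` (\<Union>w\<in>keys u. set_mset w). x \<le> n"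
    using finite_nat_set_iff_bounded_le by blast
  then show ?thesis by (intro exI[of _ "max n 1"]) force
qed

text \<open>The second index \<open>j\<close> of the acting element is taken so large that it marks the letter
  created by it; hence the contributions of words of length below \<open>L\<close> cannot cancel those of
  words of length \<open>L\<close>, which are governed by the Hankel matrices.\<close>

lemma grade_0_words:
  assumes u: "u \<in> K" "\<And>w. w \<in> keys u \<Longrightarrow> size w \<le> L" and L: "L \<ge> 1"
    and flat: "\<And>w s. w \<in> keys u \<Longrightarrow> size w = L \<Longrightarrow> s \<in># w \<Longrightarrow> grade s = 0"
    and IH: "\<And>v w. v \<in> K \<Longrightarrow> (\<And>w. size w \<ge> L \<Longrightarrow> lookup v w \<in> scalars) \<Longrightarrow> lookup v w \<in> scalars"
    and w1: "size w1 = L"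
  shows "lookup u w1 \<in> scalars"
proof (cases "w1 \<in> keys u")
  case True
  obtain n where n: "n \<ge> 1" "\<And>w s. w \<in> keys u \<Longrightarrow> s \<in># w \<Longrightarrow> snd s \<le> n"
    using letters_bounded[of u] by blast
  have words: "set_mset w \<subseteq> neg_letters" if "w \<in> keys u" for w
    using u(1) K_neg that by (auto simp: supported_on_def)
  obtain s1 where s1: "s1 \<in># w1" using L w1 by (metis gr_implies_not0 less_one multiset_nonemptyE not_less size_empty)
  \<comment> \<open>The coefficient of \<open>w0\<close> after a shift mixes those of all words
    \<open>add_mset (s i) w0\<close>. These are therefore treated together, and \<open>w1\<close> is
    one of them.\<close>
  define w0 where "w0 = w1 - {#s1#}"
  have w1': "w1 = add_mset s1 w0" using s1 by (simp add: w0_def)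
  have size0: "Suc (size w0) = L" using w1 by (simp add: w1')
  define s where "s i = (1 - int i, i)" for i
  have flat': "t = s (snd t) \<and> snd t \<in> {1..n}" if "t \<in># k" "k \<in> keys u" "size k = L" for k t
  proof -
    have "grade t = 0" "t \<in> neg_letters" using flat[of k t] words[of k] that by auto
    then show ?thesis using n(2)[of k t] that(1,2)
      by (cases t) (auto simp: s_def grade_def neg_letters_def)
  qed
  \<comment> \<open>Contracting the letter \<open>s i\<close> against an element of degree 1 yields
    the factor \<open>- i\<close>, once for each of its \<open>Suc (count w0 (s i))\<close>
    occurrences. Both factors are nonzero for \<open>i \<ge> 1\<close>.\<close>
  define f where "f i = smult (- of_nat (i * Suc (count w0 (s i)))) (lookup u (add_mset (s i) w0))" for i
  define \<psi> where "\<psi> a = \<phi> (xB (2 - int a, a))" for a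
  have main: "(\<Sum>i\<in>{1..n}. smult (\<psi> (i + m + n + 1)) (f i)) \<in> scalars" for m
  proof -
    \<comment> \<open>A bracket with \<open>p\<close> has second index at least
      \<open>j - 1\<close>, which exceeds \<open>n\<close> and hence all indices in
      \<open>u\<close>. The free parameter \<open>m\<close> runs through the rows of the Hankel
      matrix.\<close>
    define j where "j = m + n + 2"
    define p where "p = (2 - int j, j)"
    have p: "grade p = 1" "p \<notin> neg_letters" by (auto simp: p_def grade_def neg_letters_def)
    define D where "D k = act1 p k - single k (\<chi> p)" for k
    have lookup_shift: "lookup (shift p u) w = (\<Sum>k\<in>keys u. lookup u k * lookup (D k) w)" for w
      by (simp add: shift_lin_ext lookup_lin_ext D_def)
    \<comment> \<open>Brackets of degree 1 with letters of degree 0 stay in degree 1, hence outside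
      of \<open>neg_letters\<close>; so nothing is replaced and \<open>act1_contract\<close>
      applies.\<close>
    have D_flat: "lookup (D k) w = lookup (contract p k) w"
      if "k \<in> keys u" "size k = L" "Suc (size w) \<ge> L" for k w
    proof -
      have "D k - contract p k \<in> shorter (size k - 1)"
        unfolding D_def
      proof (rule act1_contract[of "{p. grade p = 1}" "{s \<in> neg_letters. grade s = 0}"])
        show "target p s \<in> {p. grade p = 1}"
          if "p \<in> {p. grade p = 1}" "s \<in> {s \<in> neg_letters. grade s = 0}" for p s
          using that by (auto simp: neg_letters_def grade_def target_def prod_eq_iff)
        show "set_mset k \<subseteq> {s \<in> neg_letters. grade s = 0}"
          using words[of k] flat[of k] that by auto
      qed (use p in \<open>auto simp: neg_letters_def\<close>)
      from supported_onD[OF this, of w] show ?thesis using that by (simp add: lookup_minus)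
    qed
    have "lookup (D k) w = 0" if "k \<in> keys u" "size w \<ge> L" for k w
    proof (cases "size k = L")
      case True
      then show ?thesis
        using D_flat[of k w] supported_onD[OF contract_size[of p k], of w] that by simp
    next
      case False
      then show ?thesis
        unfolding D_def using u(2)[OF that(1)] that words[of k] p(2) by (intro shift_larger) auto
    qed
    then have "lookup (shift p u) w \<in> scalars" if "size w \<ge> L" for w
      using that by (auto simp: lookup_shift scalars_0 intro!: sum.neutral)
    \<comment> \<open>The shift has shortened \<open>u\<close> below length \<open>L\<close>, so the
      induction hypothesis covers it.\<close>
    then have in_scalars: "lookup (shift p u) w0 \<in> scalars"
      by (rule IH[OF K_shift[OF u(1)]])
    \<comment> \<open>A word of length \<open>L\<close> reaches \<open>w0\<close> only by losing one
      letter, which by flatness is some \<open>s i\<close>. A shorter word could do so only by a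
      replacement, and the new letter would have too large a second index to occur in
      \<open>w0\<close>.\<close>
    have E0: "lookup (D k) w0 = 0" if k: "k \<in> keys u" "k \<notin> (\<lambda>i. add_mset (s i) w0) ` {1..n}" for k
    proof (cases "size k = L")
      case True
      have neq: "k - {#t#} \<noteq> w0" if "t \<in># k" for t
      proof
        assume "k - {#t#} = w0"
        then have "k = add_mset (s (snd t)) w0"
          using that flat'[OF that k(1) True] by (metis insert_DiffM)
        then show False using flat'[OF that k(1) True] k(2) by blast
      qed
      then show ?thesis
        using D_flat[OF k(1) True, of w0] size0 by (simp add: lookup_contract neq cong: image_mset_cong)
    next
      case False
      have "add_mset (target p t) (k - {#t#}) \<noteq> w0" for t
      proof
        assume "add_mset (target p t) (k - {#t#}) = w0"
        then have "target p t \<in># w1" by (auto simp: w1')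
        from n(2)[OF \<open>w1 \<in> keys u\<close> this] show False by (simp add: target_def p_def j_def)
      qed
      then show ?thesis
        unfolding D_def using shift_leading[of p k w0] p(2) words[OF k(1)] u(2)[OF k(1)] False size0
        by (auto simp: lookup_replace intro!: sum_mset.neutral)
    qed
    have E1: "lookup u (add_mset (s i) w0) * lookup (D (add_mset (s i) w0)) w0 = smult (\<psi> (i + m + n + 1)) (f i)"
      if i: "i \<in> {1..n}" for i
    proof (cases "add_mset (s i) w0 \<in> keys u")
      case True
      have eq: "(add_mset (s i) w0 - {#t#} = w0) \<longleftrightarrow> t = s i" if "t \<in># add_mset (s i) w0" for t
      proof
        assume "add_mset (s i) w0 - {#t#} = w0"
        then have "add_mset t w0 = add_mset (s i) w0" using insert_DiffM[OF that] by simp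
        then show "t = s i" by simp
      qed simp
      have "lookup (D (add_mset (s i) w0)) w0 = (\<Sum>t\<in>#add_mset (s i) w0.
          if t = s i then coeff_poly p (s i) * \<chi> (target p (s i)) else 0)"
        using D_flat[OF True, of w0] size0 unfolding lookup_contract
        by (simp only: eq cong: image_mset_cong) (auto intro!: arg_cong[where f = sum_mset] image_mset_cong)
      also have "\<dots> = of_nat (Suc (count w0 (s i))) * (coeff_poly p (s i) * \<chi> (target p (s i)))"
        by (subst sum_mset_delta) (simp add: mult.commute)
      also have "coeff_poly p (s i) = - of_nat i"
        by (simp add: coeff_poly_def coeff_int_def p_def s_def algebra_simps)
      also have "\<chi> (target p (s i)) = [:\<psi> (i + m + n + 1):]"
        using i by (auto simp: central_char_def target_def p_def s_def \<psi>_def j_def algebra_simps)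
      finally show ?thesis
        by (simp add: f_def of_nat_poly algebra_simps)
    qed (simp add: f_def in_keys_iff)
    have "lookup (shift p u) w0 = (\<Sum>k\<in>(\<lambda>i. add_mset (s i) w0) ` {1..n}. lookup u k * lookup (D k) w0)"
      unfolding lookup_shift
      by (rule sum.mono_neutral_cong) (auto simp: in_keys_iff E0)
    also have "\<dots> = (\<Sum>i\<in>{1..n}. smult (\<psi> (i + m + n + 1)) (f i))"
      using E1 by (subst sum.reindex) (auto simp: inj_on_def s_def)
    finally show ?thesis using in_scalars by simp
  qed
  have "f i \<in> scalars" if "i \<in> {1..n}" for i
  proof (rule eliminate_modulo_subspace[where A = "{1..n}" and g = "\<lambda>i m. \<psi> (i + m + n + 1)"])
    fix c :: "nat \<Rightarrow> complex" and i
    assume c: "\<And>m. (\<Sum>i\<in>{1..n}. c i * \<psi> (i + m + n + 1)) = 0" and i: "i \<in> {1..n}"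
    \<comment> \<open>Columns start at 0 and letters at 1, so column 0 gets the coefficient 0. With
      \<open>s = Suc n\<close> the entry in row \<open>m + 1\<close> and column \<open>i\<close> is
      \<open>\<psi> (i + m + n + 1)\<close>.\<close>
    have "(if i = 0 then 0 else c i) = 0"
    proof (rule good_character_independent[OF good n(1), of "Suc n"])
      fix m :: nat assume m: "m \<ge> 1"
      have "(\<Sum>j\<le>n. (if j = 0 then 0 else c j) * \<phi> (xB (2 - int (m + j + Suc n - 1), m + j + Suc n - 1)))
         = (\<Sum>j\<in>{1..n}. c j * \<psi> (j + (m - 1) + n + 1))"
        using m by (intro sum.mono_neutral_cong_right) (auto simp: \<psi>_def algebra_simps)
      then show "(\<Sum>j\<le>n. (if j = 0 then 0 else c j) * \<phi> (xB (2 - int (m + j + Suc n - 1), m + j + Suc n - 1))) = 0"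
        using c by simp
    qed (use i in auto)
    then show "c i = 0" using i by simp
  qed (use that main scalars_0 scalars_add scalars_smult in auto)
  moreover have "s1 = s (snd s1)" "snd s1 \<in> {1..n}"
    using flat'[OF s1 True w1] by auto
  ultimately have "f (snd s1) \<in> scalars" by blast
  then have "smult (- of_nat (snd s1 * Suc (count w0 s1))) (lookup u w1) \<in> scalars"
    unfolding f_def using \<open>s1 = s (snd s1)\<close> w1' by metis
  then show ?thesis
    by (rule scalars_cancel) (use \<open>snd s1 \<in> {1..n}\<close> in \<open>simp del: of_nat_mult of_nat_Suc mult_Suc_right\<close>)
qed (simp add: in_keys_iff scalars_0)

text \<open>Here \<open>h\<close> bounds the number of letters of nonzero degree in the words of
  length \<open>L\<close>. If any are left, a shift converts one of them in each contributing word
  to degree 0; the result is covered by the bound \<open>h\<close>, and a coefficient of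
  \<open>u\<close> can be read off from it.\<close>

lemma top_size_words:
  assumes L: "L \<ge> 1"
    and IH: "\<And>v w. v \<in> K \<Longrightarrow> (\<And>w. size w \<ge> L \<Longrightarrow> lookup v w \<in> scalars) \<Longrightarrow> lookup v w \<in> scalars"
  shows "u \<in> K \<Longrightarrow> (\<And>w. w \<in> keys u \<Longrightarrow> size w \<le> L) \<Longrightarrow>
    (\<And>w. w \<in> keys u \<Longrightarrow> size w = L \<Longrightarrow> size {#s \<in># w. grade s \<noteq> 0#} \<le> h) \<Longrightarrow>
    size w = L \<Longrightarrow> lookup u w \<in> scalars"
proof (induction h arbitrary: u w)
  case 0
  show ?case
  proof (rule grade_0_words[OF 0(1,2) L _ IH 0(4)])
    show "grade s = 0" if "w \<in> keys u" "size w = L" "s \<in># w" for w s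
    proof (rule ccontr)
      assume "grade s \<noteq> 0"
      then have "s \<in># {#s \<in># w. grade s \<noteq> 0#}" using that(3) by simp
      then show False using 0(3)[OF that(1,2)] by (cases s) auto
    qed
  qed
next
  case (Suc h)
  obtain u' where u': "u' \<in> K" "\<And>w. lookup u' w = (if lookup u w \<in> scalars then 0 else lookup u w)"
    using reduce_modulo_scalars[OF Suc.prems(1)] by blast
  have keys_u': "w \<in> keys u' \<longleftrightarrow> lookup u w \<notin> scalars" for w
    using scalars_0 by (auto simp: in_keys_iff u'(2))
  have keys_sub: "w \<in> keys u" if "w \<in> keys u'" for w
    using that u'(2)[of w] scalars_0 by (auto simp: in_keys_iff split: if_splits)
  define T where "T = {s. \<exists>w\<in>keys u'. size w = L \<and> s \<in># w \<and> grade s \<noteq> 0}"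
  have "T = {}"
  proof (rule ccontr)
    assume "T \<noteq> {}"
    moreover have "finite T"
      by (rule finite_subset[of _ "\<Union>w\<in>keys u'. set_mset w"]) (auto simp: T_def)
    ultimately obtain s1 where s1: "s1 \<in> T" "\<And>s. s \<in> T \<Longrightarrow> grade s1 \<le> grade s"
      using arg_min_if_finite(1)[of T grade] arg_min_least[of T _ grade] by metis
    then obtain w1 where w1: "w1 \<in> keys u'" "size w1 = L" "s1 \<in># w1" "grade s1 \<noteq> 0"
      by (auto simp: T_def)
    have words: "set_mset w \<subseteq> neg_letters" if "w \<in> keys u'" for w
      using u'(1) K_neg that by (auto simp: supported_on_def)
    define d where "d = - grade s1"
    have d: "d \<ge> 1" using words[OF w1(1)] w1(3,4) by (auto simp: d_def neg_letters_def)
    obtain n where n: "\<And>w s. w \<in> keys u' \<Longrightarrow> s \<in># w \<Longrightarrow> snd s \<le> n"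
      using letters_bounded[of u'] by blast
    \<comment> \<open>Large enough that every letter created by \<open>p\<close> has second index at
      least \<open>n + 1\<close> and so differs from all letters of \<open>u'\<close>.\<close>
    define j where "j = n + 2"
    define p where "p = (d + 1 - int j, j)"
    have p: "grade p = d" "p \<notin> neg_letters" "0 < snd p"
      using d by (auto simp: p_def grade_def neg_letters_def j_def)
    define v where "v = shift p u'"
    have v: "v \<in> K" by (simp add: v_def K_shift u')
    have lookup_v: "lookup v w = (\<Sum>k\<in>keys u'. if size k = L then lookup u' k * lookup (replace p k) w else 0)"
      if "size w \<ge> L" for w
      unfolding v_def shift_lin_ext lookup_lin_ext
    proof (intro sum.cong refl)
      fix k assume k: "k \<in> keys u'"
      then have "size k \<le> L" using Suc.prems(2) keys_sub by blast
      then show "lookup u' k * lookup (act1 p k - single k (\<chi> p)) w =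
          (if size k = L then lookup u' k * lookup (replace p k) w else 0)"
        using shift_leading[of p k w] shift_larger[of p k w] words[OF k] p(2) that by auto
    qed
    have size_v: "size w \<le> L" if "w \<in> keys v" for w
    proof (rule ccontr)
      assume *: "\<not> size w \<le> L"
      then have "lookup v w = 0"
        using supported_onD[OF replace_size[of p], of w] by (auto simp: lookup_v intro!: sum.neutral)
      with that show False by (simp add: in_keys_iff)
    qed
    \<comment> \<open>The minimality of the degree enters here: if the bracket with \<open>p\<close>
      stays in \<open>neg_letters\<close>, the degree of \<open>s\<close> is at most
      \<open>- d\<close>, hence equal to it, and the new letter has degree 0.\<close>
    have letter: "grade s = - d" if "k \<in> keys u'" "size k = L" "s \<in># k" "target p s \<in> neg_letters" for k s
    proof -
      have "grade s \<ge> - d"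
        using s1(2)[of s] that d by (cases "grade s = 0") (auto simp: T_def d_def)
      moreover have "grade s + d \<le> 0"
        using grade_target_pos[OF p(3), of s] that(4) p(1) by (simp add: neg_letters_def)
      ultimately show ?thesis by simp
    qed
    have count_v: "size {#s \<in># w. grade s \<noteq> 0#} \<le> h" if "w \<in> keys v" "size w = L" for w
    proof -
      from that have "(\<Sum>k\<in>keys u'. if size k = L then lookup u' k * lookup (replace p k) w else 0) \<noteq> 0"
        by (simp add: lookup_v in_keys_iff)
      then obtain k where "k \<in> keys u'" "(if size k = L then lookup u' k * lookup (replace p k) w else 0) \<noteq> 0"
        by (rule sum.not_neutral_contains_not_neutral)
      then have k: "k \<in> keys u'" "size k = L" "lookup (replace p k) w \<noteq> 0"
        by (auto split: if_splits)
      have "\<exists>s. s \<in># k \<and> target p s \<in> neg_letters \<and> add_mset (target p s) (k - {#s#}) = w"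
      proof (rule ccontr)
        assume no: "\<nexists>s. s \<in># k \<and> target p s \<in> neg_letters \<and> add_mset (target p s) (k - {#s#}) = w"
        have "lookup (replace p k) w = (\<Sum>s\<in>#k. 0)"
          unfolding lookup_replace using no by (intro arg_cong[where f = sum_mset] image_mset_cong) auto
        with k(3) show False by simp
      qed
      then obtain s where s: "s \<in># k" "target p s \<in> neg_letters" "add_mset (target p s) (k - {#s#}) = w"
        by blast
      have "grade s = - d" using letter k s by blast
      then have "grade (target p s) = 0" "grade s \<noteq> 0"
        using grade_target_pos[OF p(3), of s] p(1) d by auto
      moreover have "size {#s \<in># k. grade s \<noteq> 0#} \<le> Suc h"
        using Suc.prems(3) keys_sub k by blast
      moreover obtain k' where "k = add_mset s k'" using s(1) by (auto dest: multi_member_split)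
      ultimately show ?thesis using s(3) by auto
    qed
    have "lookup v w \<in> scalars" if "size w = L" for w
      using Suc.IH[OF v size_v count_v that] by blast
    \<comment> \<open>\<open>w1\<close> with one \<open>s1\<close> exchanged for the letter created
      from it. The size of its second index identifies that letter, and it determines
      \<open>s1\<close>; so no word other than \<open>w1\<close> contributes to
      \<open>w2\<close>.\<close>
    moreover define w2 where "w2 = add_mset (target p s1) (w1 - {#s1#})"
    moreover have size_w2: "size w2 = L" using w1(2,3) by (auto simp: w2_def dest: multi_member_split)
    ultimately have "lookup v w2 \<in> scalars" by blast
    also have "lookup v w2 = (\<Sum>k\<in>keys u'. if k = w1 then lookup u' k * (coeff_poly p s1 * of_nat (count w1 s1)) else 0)"
      unfolding lookup_v[OF size_w2[THEN eq_refl[OF sym]]]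
    proof (intro sum.cong refl)
      fix k assume k: "k \<in> keys u'"
      have eq: "(target p s \<in> neg_letters \<and> add_mset (target p s) (k - {#s#}) = w2) \<longleftrightarrow> k = w1 \<and> s = s1"
        if "size k = L" "s \<in># k" for s
      proof
        assume *: "target p s \<in> neg_letters \<and> add_mset (target p s) (k - {#s#}) = w2"
        have "target p s1 \<notin># k - {#s#}"
          using n[OF k, of "target p s1"] by (auto dest!: in_diffD simp: target_def p_def j_def)
        with * have t: "target p s = target p s1" "k - {#s#} = w1 - {#s1#}"
          by (auto simp: w2_def add_eq_conv_ex)
        then have "s = s1" by (auto simp: target_def p_def j_def prod_eq_iff)
        with t(2) that(2) w1(3) show "k = w1 \<and> s = s1"
          by (metis insert_DiffM)
      next
        assume *: "k = w1 \<and> s = s1"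
        have "grade (target p s1) = 0" using grade_target_pos[OF p(3), of s1] p(1) by (simp add: d_def)
        moreover have "target p s1 \<noteq> (1, 0)" by (simp add: target_def p_def j_def)
        ultimately show "target p s \<in> neg_letters \<and> add_mset (target p s) (k - {#s#}) = w2"
          using * by (auto simp: w2_def neg_letters_def)
      qed
      have "lookup (replace p k) w2 = (\<Sum>s\<in>#k. if s = s1 then if k = w1 then coeff_poly p s1 else 0 else 0)"
        if "size k = L"
        unfolding lookup_replace using eq[OF that]
        by (intro arg_cong[where f = sum_mset] image_mset_cong) auto
      then show "(if size k = L then lookup u' k * lookup (replace p k) w2 else 0) =
          (if k = w1 then lookup u' k * (coeff_poly p s1 * of_nat (count w1 s1)) else 0)"
        using w1(2) by (auto simp: sum_mset_delta)
    qed
    also have "\<dots> = lookup u' w1 * (coeff_poly p s1 * of_nat (count w1 s1))"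
      using w1(1) by simp
    also have "\<dots> = smult (of_int (coeff_int p s1 * int (count w1 s1))) (lookup u' w1)"
      by (simp add: coeff_poly_def of_int_poly of_nat_poly mult.commute)
    finally have "smult (of_int (coeff_int p s1 * int (count w1 s1))) (lookup u' w1) \<in> scalars" .
    moreover have "coeff_int p s1 = - d * (int (snd s1) + int j)"
      by (simp add: coeff_int_def p_def d_def grade_def algebra_simps)
    then have "coeff_int p s1 \<noteq> 0" using d by (auto simp: j_def)
    then have "of_int (coeff_int p s1 * int (count w1 s1)) \<noteq> (0::complex)"
      using w1(3) by (simp only: of_int_eq_0_iff) simp
    ultimately have "lookup u' w1 \<in> scalars" by (rule scalars_cancel)
    then show False using w1(1) by (auto simp: u'(2) keys_u' scalars_0 split: if_splits)
  qed
  then have "lookup u' w \<in> scalars"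
    by (intro grade_0_words[OF u'(1) _ L _ IH Suc.prems(4)])
      (use Suc.prems(2) keys_sub in \<open>auto simp: T_def\<close>)
  then show ?case by (auto simp: u'(2) split: if_splits)
qed

text \<open>Induction on a length \<open>L\<close> from which on all coefficients are known to lie
  in the ideal; each step lowers it by one. At the bottom the reduced element is a single scalar in
  \<open>K\<close>, and the definition of \<open>scalars\<close> applies.\<close>

theorem coefficients_in_scalars:
  assumes "u \<in> K"
  shows "lookup u w \<in> scalars"
proof -
  have "lookup u w \<in> scalars" if "u \<in> K" "\<And>w. size w \<ge> L \<Longrightarrow> lookup u w \<in> scalars" for u w L
    using that
  proof (induction L arbitrary: u w)
    case (Suc L)
    obtain u' where u': "u' \<in> K" "\<And>w. lookup u' w = (if lookup u w \<in> scalars then 0 else lookup u w)"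
      using reduce_modulo_scalars[OF Suc.prems(1)] by blast
    have size: "size w \<le> L" if "w \<in> keys u'" for w
      using that Suc.prems(2)[of w] by (force simp: in_keys_iff u'(2))
    have "lookup u' w \<in> scalars" if w: "size w = L" for w
    proof (cases "L = 0")
      case True
      then have "u' = single 0 (lookup u' {#})"
        using size by (intro poly_mapping_eqI) (auto simp: lookup_single when_def in_keys_iff)
      then show ?thesis using u'(1) w True by (simp add: scalars_def)
    next
      case False
      then show ?thesis
        using top_size_words[OF _ _ u'(1) size, of L w] Suc.IH w size_filter_mset_lesseq
        by (metis One_nat_def Suc_leI neq0_conv)
    qed
    then have "lookup u w \<in> scalars" if w: "size w = L" for w
      using w u'(2)[of w] by (metis (full_types))
    then have "lookup u w \<in> scalars" if w: "size w \<ge> L" for w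
      using w Suc.prems(2)[of w] by (cases "size w = L") auto
    then show ?case by (rule Suc.IH[OF Suc.prems(1)])
  qed auto
  moreover obtain L where L: "\<forall>w\<in>keys u. size w \<le> L"
    using finite_nat_set_iff_bounded_le[of "size ` keys u"] by auto
  have "lookup u w \<in> scalars" if "size w \<ge> Suc L" for w
  proof -
    have "w \<notin> keys u" using L that by force
    then show ?thesis by (simp add: in_keys_iff scalars_0)
  qed
  ultimately show ?thesis using assms by blast
qed

end

section \<open>The tensor algebra and the enveloping algebra\<close>

lemma poly_mapping_sum_singles:
  fixes t :: "'k \<Rightarrow>\<^sub>0 'b::comm_monoid_add"
  shows "t = (\<Sum>k\<in>keys t. single k (lookup t k))"
  by (rule poly_mapping_eqI) (auto simp: lookup_sum lookup_single when_def in_keys_iff)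

lemma poly_mapping_additive_induct [case_names zero single add]:
  fixes t :: "'k \<Rightarrow>\<^sub>0 'b::comm_monoid_add"
  assumes "P 0" "\<And>k c. P (single k c)" "\<And>s t. P s \<Longrightarrow> P t \<Longrightarrow> P (s + t)"
  shows "P t"
proof -
  have "P (\<Sum>k\<in>A. single k (lookup t k))" if "finite A" for A
    using that by (induction A rule: finite_induct) (auto intro: assms)
  then have "P (\<Sum>k\<in>keys t. single k (lookup t k))" by simp
  then show ?thesis by (simp only: poly_mapping_sum_singles [symmetric])
qed

abbreviation letter :: "'a \<Rightarrow> 'a word \<Rightarrow>\<^sub>0 complex"
  where "letter p \<equiv> single (Word [p]) 1"

lemma letters_0 [simp]: "letters 0 = []"
  by (simp add: zero_word_def)

lemma Word_Nil [simp]: "Word [] = 0"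
  by (rule zero_word_def [symmetric])

lemma letters_add [simp]: "letters (u + v) = letters u @ letters v"
  by (simp add: plus_word_def)

lemma Word_add: "Word xs + Word ys = Word (xs @ ys)"
  by (simp add: plus_word_def)

lemma letter_mult: "letter p * single (Word xs) a = single (Word (p # xs)) a"
  by (simp add: mult_single Word_add)

lemma letter_mult_left: "letter p * (single (Word xs) a * t) = single (Word (p # xs)) a * t"
  by (simp only: letter_mult mult.assoc [symmetric])

lemma scalar_comm:
  fixes t :: "'w::monoid_add \<Rightarrow>\<^sub>0 'r::comm_semiring_1"
  shows "t * single 0 a = single 0 a * t"
proof (induction t rule: poly_mapping_additive_induct)
qed (simp_all add: mult_single mult.commute distrib_left distrib_right)

lemma lookup_B_scale [simp]: "lookup (B_scale c x) p = c * lookup x p"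
  by (simp add: B_scale_def Poly_Mapping.map.rep_eq when_def)

lemma B_scale_xB [simp]: "B_scale c (xB p) = single p c"
  by (rule poly_mapping_eqI) (simp add: xB_def lookup_single when_def)

lemma \<iota>_superset:
  "finite A \<Longrightarrow> keys x \<subseteq> A \<Longrightarrow> \<iota> x = (\<Sum>p\<in>A. single (Word [p]) (lookup x p))"
  unfolding \<iota>_def by (intro sum.mono_neutral_left) (auto simp: in_keys_iff)

lemma \<iota>_add: "\<iota> (x + y) = \<iota> x + \<iota> y"
  using keys_add[of x y]
  by (simp add: \<iota>_superset[of "keys x \<union> keys y"] lookup_add single_add sum.distrib)

lemma \<iota>_single [simp]: "\<iota> (single p c) = single (Word [p]) c"
  by (simp add: \<iota>_superset[of "{p}"])

lemma \<iota>_xB [simp]: "\<iota> (xB p) = letter p"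
  by (simp add: xB_def)

lemma \<iota>_scale: "\<iota> (B_scale c x) = single 0 c * \<iota> x"
proof -
  have "keys (B_scale c x) \<subseteq> keys x" by (auto simp: in_keys_iff)
  then show ?thesis
    by (simp add: \<iota>_superset[of "keys x"] sum_distrib_left mult_single)
qed

lemma ring_type_algebra_simps [simp]:
  "carrier (ring_of_type_algebra :: 'a::ring_1 ring) = UNIV"
  "x \<otimes>\<^bsub>(ring_of_type_algebra :: 'a ring)\<^esub> y = x * y"
  "x \<oplus>\<^bsub>(ring_of_type_algebra :: 'a ring)\<^esub> y = x + y"
  "\<one>\<^bsub>(ring_of_type_algebra :: 'a ring)\<^esub> = 1"
  "\<zero>\<^bsub>(ring_of_type_algebra :: 'a ring)\<^esub> = 0"
  by (simp_all add: ring_of_type_algebra_def)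

lemma ring_type_algebra: "ring (ring_of_type_algebra :: 'a::ring_1 ring)"
proof -
  have "\<exists>y. x + y = 0 \<and> y + x = 0" for x :: 'a
    by (intro exI[of _ "- x"]) simp
  then show ?thesis
    by unfold_locales (auto simp: algebra_simps Units_def)
qed

lemma ring_type_algebra_uminus [simp]: "\<ominus>\<^bsub>(ring_of_type_algebra :: 'a::ring_1 ring)\<^esub> x = - x"
proof -
  interpret ring "ring_of_type_algebra :: 'a ring" by (rule ring_type_algebra)
  show ?thesis by (rule minus_equality[symmetric, THEN sym]) auto
qed

lemma ideal_type_algebraI:
  fixes I :: "'a::ring_1 set"
  assumes "0 \<in> I" "\<And>x y. x \<in> I \<Longrightarrow> y \<in> I \<Longrightarrow> x + y \<in> I"
    and l: "\<And>x y. x \<in> I \<Longrightarrow> y * x \<in> I" and "\<And>x y. x \<in> I \<Longrightarrow> x * y \<in> I"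
  shows "ideal I ring_of_type_algebra"
proof (rule idealI[OF ring_type_algebra])
  interpret ring "ring_of_type_algebra :: 'a ring" by (rule ring_type_algebra)
  have "- x \<in> I" if "x \<in> I" for x using l[OF that, of "-1"] by simp
  then show "subgroup I (add_monoid ring_of_type_algebra)"
    using assms by (intro add.subgroupI) auto
qed (use assms in auto)

lemma ideal_type_algebraD:
  fixes I :: "'a::ring_1 set"
  assumes "ideal I ring_of_type_algebra"
  shows "0 \<in> I" "\<And>x y. x \<in> I \<Longrightarrow> y \<in> I \<Longrightarrow> x + y \<in> I"
    "\<And>x y. x \<in> I \<Longrightarrow> y * x \<in> I" "\<And>x y. x \<in> I \<Longrightarrow> x * y \<in> I"
proof -
  interpret ideal I ring_of_type_algebra by fact
  show "0 \<in> I" "\<And>x y. x \<in> I \<Longrightarrow> y \<in> I \<Longrightarrow> x + y \<in> I"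
    "\<And>x y. x \<in> I \<Longrightarrow> y * x \<in> I" "\<And>x y. x \<in> I \<Longrightarrow> x * y \<in> I"
    using additive_subgroup.zero_closed[OF is_additive_subgroup]
      additive_subgroup.a_closed[OF is_additive_subgroup] I_l_closed I_r_closed by auto
qed

lemma ideal_U_ideal: "ideal U_ideal tensor_alg"
  unfolding U_ideal_def by (rule ring.genideal_ideal[OF ring_type_algebra]) simp

lemmas U_ideal_closed = ideal_type_algebraD[OF ideal_U_ideal]

lemma U_ideal_minimal:
  assumes "ideal I tensor_alg" "\<And>x y. \<iota> x * \<iota> y - \<iota> y * \<iota> x - \<iota> (B_bracket x y) \<in> I"
  shows "U_ideal \<subseteq> I"
  unfolding U_ideal_def using assms by (intro ring.genideal_minimal[OF ring_type_algebra]) auto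

lemma commutator_in_U_ideal: "\<iota> x * \<iota> y - \<iota> y * \<iota> x - \<iota> (B_bracket x y) \<in> U_ideal"
  unfolding U_ideal_def by (rule subsetD[OF ring.genideal_self[OF ring_type_algebra]]) auto

lemma letter_commutator:
  "letter p * letter q - letter q * letter p - single (Word [target p q]) (of_int (coeff_int p q)) \<in> U_ideal"
  using commutator_in_U_ideal[of "xB p" "xB q"] by (simp add: B_bracket_xB xB_bracket_conv)

section \<open>Polynomials in the central element\<close>

lemma poly_in_center_superset:
  assumes "degree p \<le> n"
  shows "poly_in_center p = (\<Sum>k\<le>n. single 0 (coeff p k) * letter (1, 0) ^ k)"
  unfolding poly_in_center_def using assms
  by (intro sum.mono_neutral_cong_left) (auto simp: coeff_eq_0)

lemma poly_in_center_add: "poly_in_center (p + q) = poly_in_center p + poly_in_center q"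
  using degree_add_le_max[of p q]
  by (simp add: poly_in_center_superset[of _ "max (degree p) (degree q)"] single_add distrib_right sum.distrib)

lemma poly_in_center_0 [simp]: "poly_in_center 0 = 0"
  by (simp add: poly_in_center_def)

lemma poly_in_center_const [simp]: "poly_in_center [:a:] = single 0 a"
  by (simp add: poly_in_center_def)

lemma poly_in_center_1 [simp]: "poly_in_center 1 = 1"
  using poly_in_center_const[of 1] by (simp add: one_pCons)

lemma poly_in_center_smult: "poly_in_center (smult a p) = single 0 a * poly_in_center p"
proof -
  have "degree (smult a p) \<le> degree p" by simp
  then show ?thesis
    by (simp add: poly_in_center_superset[of _ "degree p"] sum_distrib_left mult_single flip: mult.assoc)
qed

lemma poly_in_center_pCons: "poly_in_center (pCons a p) = single 0 a + letter (1, 0) * poly_in_center p"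
proof -
  have "poly_in_center (pCons a p) = (\<Sum>k\<le>Suc (degree p). single 0 (coeff (pCons a p) k) * letter (1, 0) ^ k)"
    by (rule poly_in_center_superset) (simp add: degree_pCons_le)
  also have "\<dots> = single 0 a + (\<Sum>k\<le>degree p. single 0 (coeff p k) * letter (1, 0) ^ Suc k)"
    by (subst sum.atMost_Suc_shift) simp
  also have "(\<Sum>k\<le>degree p. single 0 (coeff p k) * letter (1, 0) ^ Suc k) = letter (1, 0) * poly_in_center p"
    by (simp add: poly_in_center_superset[of p "degree p"] sum_distrib_left scalar_comm flip: mult.assoc)
  finally show ?thesis .
qed

lemma poly_in_center_mult: "poly_in_center (p * q) = poly_in_center p * poly_in_center q"
proof (induction p)
  case (pCons a p)
  then show ?case
    by (simp add: poly_in_center_add poly_in_center_smult poly_in_center_pCons distrib_right mult.assoc)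
qed simp

text \<open>The structure constants with \<open>(1, 0)\<close> are zero, so modulo
  \<open>U_ideal\<close> it passes each letter of a word in turn.\<close>

lemma letter_central: "letter (1, 0) * t - t * letter (1, 0) \<in> U_ideal"
proof (induction t rule: poly_mapping_additive_induct)
  case zero
  then show ?case by (simp add: U_ideal_closed)
next
  case (single w c)
  have "letter (1, 0) * single (Word xs) 1 - single (Word xs) 1 * letter (1, 0) \<in> U_ideal" for xs
  proof (induction xs)
    case Nil
    then show ?case by (simp add: U_ideal_closed)
  next
    case (Cons p xs)
    have "letter (1, 0) * letter p - letter p * letter (1, 0) \<in> U_ideal"
      using letter_commutator[of "(1, 0)" p] by (simp add: coeff_int_def)
    from U_ideal_closed(2)[OF U_ideal_closed(4)[OF this, of "single (Word xs) 1"]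
        U_ideal_closed(3)[OF Cons, of "letter p"]]
    show ?case by (simp add: algebra_simps letter_mult mult_single Word_add)
  qed
  from U_ideal_closed(3)[OF this[of "letters w"], of "single 0 c"]
  show ?case by (simp add: right_diff_distrib mult_single flip: mult.assoc) 
next
  case (add s t)
  from U_ideal_closed(2)[OF add] show ?case by (simp add: algebra_simps)
qed

lemma poly_in_center_central: "poly_in_center f * t - t * poly_in_center f \<in> U_ideal"
proof (induction f)
  case 0
  then show ?case by (simp add: U_ideal_closed)
next
  case (pCons a f)
  from U_ideal_closed(2)[OF U_ideal_closed(3)[OF pCons(2), of "letter (1, 0)"]
      U_ideal_closed(4)[OF letter_central[of t], of "poly_in_center f"]]
  show ?case by (simp add: poly_in_center_pCons algebra_simps scalar_comm)
qed

section \<open>Modules\<close>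

locale lie_module =
  fixes V :: "'v B_mod" (structure)
  assumes B_module: "B_module V"
begin

sublocale module complex_ring V
  using B_module by (simp add: B_module_def)

lemma act_closed [simp, intro]: "v \<in> carrier V \<Longrightarrow> act V x v \<in> carrier V"
  and act_add_right: "v \<in> carrier V \<Longrightarrow> w \<in> carrier V \<Longrightarrow> act V x (v \<oplus> w) = act V x v \<oplus> act V x w"
  and act_smult_right: "v \<in> carrier V \<Longrightarrow> act V x (c \<odot> v) = c \<odot> act V x v"
  and act_add_left: "v \<in> carrier V \<Longrightarrow> act V (x + y) v = act V x v \<oplus> act V y v"
  and act_smult_left: "v \<in> carrier V \<Longrightarrow> act V (B_scale c x) v = c \<odot> act V x v"
  and act_bracket: "v \<in> carrier V \<Longrightarrow>
    act V (B_bracket x y) v = act V x (act V y v) \<ominus> act V y (act V x v)"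
  using B_module by (auto simp: B_module_def)

lemma smult_closed' [simp, intro]: "v \<in> carrier V \<Longrightarrow> c \<odot> v \<in> carrier V"
  by simp

definition word_act :: "(int \<times> nat) word \<Rightarrow> 'v \<Rightarrow> 'v"
  where "word_act w = foldr (\<lambda>p. act V (xB p)) (letters w)"

lemma word_act_0 [simp]: "word_act 0 v = v"
  and word_act_Cons: "word_act (Word (p # xs)) v = act V (xB p) (word_act (Word xs) v)"
  and word_act_plus: "word_act (u + w) v = word_act u (word_act w v)"
  by (simp_all add: word_act_def)

lemma word_act_linear:
  assumes "v \<in> carrier V" "w \<in> carrier V"
  shows "word_act u v \<in> carrier V"
    "word_act u (v \<oplus> w) = word_act u v \<oplus> word_act u w"
    "word_act u (c \<odot> v) = c \<odot> word_act u v"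
proof -
  have "foldr (\<lambda>p. act V (xB p)) xs v \<in> carrier V" if "v \<in> carrier V" for v xs
    using that by (induction xs) auto
  note closed = this
  show "word_act u v \<in> carrier V" using closed assms by (simp add: word_act_def)
  have "foldr (\<lambda>p. act V (xB p)) xs (v \<oplus> w) =
      foldr (\<lambda>p. act V (xB p)) xs v \<oplus> foldr (\<lambda>p. act V (xB p)) xs w" for xs
    using assms by (induction xs) (auto simp: act_add_right closed)
  then show "word_act u (v \<oplus> w) = word_act u v \<oplus> word_act u w" by (simp add: word_act_def)
  have "foldr (\<lambda>p. act V (xB p)) xs (c \<odot> v) = c \<odot> foldr (\<lambda>p. act V (xB p)) xs v" for xs
    using assms by (induction xs) (auto simp: act_smult_right closed)
  then show "word_act u (c \<odot> v) = c \<odot> word_act u v" by (simp add: word_act_def)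
qed

lemmas word_act_closed [simp, intro] = word_act_linear(1)[OF _ zero_closed]
lemmas word_act_smult = word_act_linear(3)[OF _ zero_closed]

lemma T_act_superset:
  assumes "finite A" "keys t \<subseteq> A" "v \<in> carrier V"
  shows "T_act V t v = (\<Oplus>w\<in>A. lookup t w \<odot> word_act w v)"
  unfolding T_act_def word_act_def[symmetric] using assms
  by (intro add.finprod_mono_neutral_cong_left) (auto simp: in_keys_iff smult_l_null[simplified])

lemma T_act_closed [simp, intro]: "v \<in> carrier V \<Longrightarrow> T_act V t v \<in> carrier V"
  unfolding T_act_def word_act_def[symmetric] by (intro finsum_closed) auto

lemma T_act_add:
  assumes "v \<in> carrier V"
  shows "T_act V (s + t) v = T_act V s v \<oplus> T_act V t v"
proof -
  have "(\<Oplus>w\<in>keys s \<union> keys t. lookup (s + t) w \<odot> word_act w v) =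
      (\<Oplus>w\<in>keys s \<union> keys t. lookup s w \<odot> word_act w v \<oplus> lookup t w \<odot> word_act w v)"
    using assms by (intro finsum_cong) (auto simp: lookup_add smult_l_distr[simplified] simp_implies_def)
  also have "\<dots> = (\<Oplus>w\<in>keys s \<union> keys t. lookup s w \<odot> word_act w v) \<oplus>
      (\<Oplus>w\<in>keys s \<union> keys t. lookup t w \<odot> word_act w v)"
    using assms by (intro finsum_addf) auto
  finally show ?thesis
    using keys_add[of s t] assms by (simp add: T_act_superset[of "keys s \<union> keys t"])
qed

lemma T_act_single [simp]: "v \<in> carrier V \<Longrightarrow> T_act V (single w c) v = c \<odot> word_act w v"
  by (simp add: T_act_superset[of "{w}"])

lemma T_act_0 [simp]: "T_act V 0 v = \<zero>"
  by (simp add: T_act_def)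

lemma T_act_scalar: "v \<in> carrier V \<Longrightarrow> T_act V (single 0 c) v = c \<odot> v"
  by simp

lemma T_act_one [simp]: "v \<in> carrier V \<Longrightarrow> T_act V 1 v = v"
  using T_act_scalar[of v 1] smult_one by simp

lemma T_act_right_add:
  "v \<in> carrier V \<Longrightarrow> w \<in> carrier V \<Longrightarrow> T_act V t (v \<oplus> w) = T_act V t v \<oplus> T_act V t w"
proof (induction t rule: poly_mapping_additive_induct)
  case (add s t)
  then show ?case by (simp add: T_act_add a_ac)
qed (auto simp: word_act_linear smult_r_distr)

lemma T_act_mult: "v \<in> carrier V \<Longrightarrow> T_act V (s * t) v = T_act V s (T_act V t v)"
proof (induction s rule: poly_mapping_additive_induct)
  case (single w c)
  show ?case
  proof (induction t rule: poly_mapping_additive_induct)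
    case zero
    then show ?case using T_act_right_add[of \<zero> \<zero> "single w c"] single
      by (metis T_act_0 T_act_closed T_act_one T_act_add add.l_cancel_one' l_zero mult_zero_right zero_closed)
  next
    case (single w' c')
    then show ?case using \<open>v \<in> carrier V\<close> smult_assoc1[of c c']
      by (simp add: mult_single word_act_plus word_act_smult)
  next
    case (add s t)
    then show ?case using \<open>v \<in> carrier V\<close> by (simp add: distrib_left T_act_add T_act_right_add)
  qed
qed (simp_all add: distrib_right T_act_add)

lemma T_act_uminus: "v \<in> carrier V \<Longrightarrow> T_act V (- t) v = \<ominus> T_act V t v"
  using T_act_add[of v "- t" t] M.minus_equality[of "T_act V (- t) v" "T_act V t v"] by simp

lemma T_act_diff: "v \<in> carrier V \<Longrightarrow> T_act V (s - t) v = T_act V s v \<ominus> T_act V t v"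
  using T_act_add[of v s "- t"] by (simp add: T_act_uminus a_minus_def)

lemma minus_eq_zero_iff: "a \<in> carrier V \<Longrightarrow> b \<in> carrier V \<Longrightarrow> a \<ominus> b = \<zero> \<longleftrightarrow> a = b"
  by (metis M.minus_equality a_minus_def add.inv_closed M.minus_minus r_neg)

lemma T_act_diff_eq_0_iff:
  "v \<in> carrier V \<Longrightarrow> T_act V (s - t) v = \<zero> \<longleftrightarrow> T_act V s v = T_act V t v"
  by (simp add: T_act_diff minus_eq_zero_iff)

lemma T_act_\<iota> [simp]: "v \<in> carrier V \<Longrightarrow> T_act V (\<iota> x) v = act V x v"
proof (induction x rule: poly_mapping_additive_induct)
  case zero
  have "B_scale 0 0 = (0 :: B)" by (rule poly_mapping_eqI) simp
  then show ?case using act_smult_left[of v 0 0] smult_l_null[of "act V 0 v"] zero by (simp add: \<iota>_def)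
next
  case (single p c)
  then show ?case
    using act_smult_left[of v c "xB p"] by (simp add: word_act_Cons)
next
  case (add x y)
  then show ?case by (simp add: \<iota>_add T_act_add act_add_left)
qed

lemma T_act_zero [simp]: "T_act V t \<zero> = \<zero>"
  using T_act_mult[of \<zero> t 0] by simp

text \<open>The tensors that act as zero on all of \<open>V\<close> form a two-sided ideal, and it
  contains the generators of \<open>U_ideal\<close> because \<open>act\<close> respects
  brackets.\<close>

lemma T_act_U_ideal: "t \<in> U_ideal \<Longrightarrow> v \<in> carrier V \<Longrightarrow> T_act V t v = \<zero>"
proof -
  let ?I = "{t. \<forall>v\<in>carrier V. T_act V t v = \<zero>}"
  have "U_ideal \<subseteq> ?I"
  proof (rule U_ideal_minimal)
    show "ideal ?I tensor_alg"
      by (rule ideal_type_algebraI) (auto simp: T_act_add T_act_mult)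
    show "\<iota> x * \<iota> y - \<iota> y * \<iota> x - \<iota> (B_bracket x y) \<in> ?I" for x y
      by (auto simp: T_act_diff T_act_mult act_bracket minus_eq_zero_iff)
  qed
  then show "t \<in> U_ideal \<Longrightarrow> v \<in> carrier V \<Longrightarrow> T_act V t v = \<zero>" by auto
qed

lemma T_act_submodule:
  assumes "B_submodule W V" "v \<in> W"
  shows "T_act V t v \<in> W"
proof -
  have sub: "submodule W complex_ring V" and act: "\<And>x w. w \<in> W \<Longrightarrow> act V x w \<in> W"
    using assms(1) by (auto simp: B_submodule_def)
  note W = submoduleE[OF sub]
  have word: "foldr (\<lambda>p. act V (xB p)) xs v \<in> W" for xs
    by (induction xs) (use assms(2) act in auto)
  have v: "v \<in> carrier V" using W(1) assms(2) by auto
  show ?thesis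
  proof (induction t rule: poly_mapping_additive_induct)
    case zero
    then show ?case using W(4)[OF _ assms(2), of 0] v smult_l_null[of v] by simp
  next
    case (single w c)
    then show ?case using W(4)[of c] v word[of "letters w"] by (simp add: word_act_def)
  next
    case (add s t)
    then show ?case using W(5) v by (simp add: T_act_add)
  qed
qed

lemma generated_by_iff:
  "generated_by V v \<longleftrightarrow> v \<in> carrier V \<and> carrier V = range (\<lambda>t. T_act V t v)"
proof (intro iffI conjI)
  assume gen: "generated_by V v"
  then show v: "v \<in> carrier V" by (simp add: generated_by_def)
  have "submodule (range (\<lambda>t. T_act V t v)) complex_ring V"
  proof (rule submoduleI)
    show "\<zero> \<in> range (\<lambda>t. T_act V t v)" using T_act_0 by (metis rangeI)
    show "\<ominus> a \<in> range (\<lambda>t. T_act V t v)" if "a \<in> range (\<lambda>t. T_act V t v)" for a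
      using that v by (auto simp flip: T_act_uminus)
    show "a \<oplus> b \<in> range (\<lambda>t. T_act V t v)"
      if "a \<in> range (\<lambda>t. T_act V t v)" "b \<in> range (\<lambda>t. T_act V t v)" for a b
      using that v by (auto simp flip: T_act_add)
    show "c \<odot> a \<in> range (\<lambda>t. T_act V t v)" if "a \<in> range (\<lambda>t. T_act V t v)" for c a
      using that v by (auto simp flip: T_act_scalar T_act_mult simp del: T_act_single)
  qed (use v in auto)
  moreover have "act V x w \<in> range (\<lambda>t. T_act V t v)" if "w \<in> range (\<lambda>t. T_act V t v)" for x w
    using that v by (auto simp flip: T_act_\<iota> T_act_mult)
  ultimately have "B_submodule (range (\<lambda>t. T_act V t v)) V" by (simp add: B_submodule_def)
  moreover have "v \<in> range (\<lambda>t. T_act V t v)" using T_act_one[OF v] by (metis rangeI)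
  ultimately show "carrier V = range (\<lambda>t. T_act V t v)" using gen by (auto simp: generated_by_def)
next
  assume *: "v \<in> carrier V \<and> carrier V = range (\<lambda>t. T_act V t v)"
  show "generated_by V v"
    unfolding generated_by_def
  proof (intro conjI allI impI)
    fix W assume W: "B_submodule W V \<and> v \<in> W"
    then have "W \<subseteq> carrier V" using submoduleE(1) by (auto simp: B_submodule_def)
    moreover have "carrier V \<subseteq> W" using * T_act_submodule[of W v] W by auto
    ultimately show "W = carrier V" by (rule equalityI)
  qed (use * in blast)
qed

end

section \<open>Annihilators in the enveloping algebra\<close>

lemma U_proj_iff: "s \<in> U_proj t \<longleftrightarrow> s - t \<in> U_ideal"
  by (auto simp: U_proj_def a_r_coset_def' intro!: bexI[of _ "s - t"])

lemma U_proj_self: "t \<in> U_proj t"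
  by (simp add: U_proj_iff U_ideal_closed)

lemma U_proj_in_carrier [simp]: "U_proj t \<in> carrier U_alg"
  by (auto simp: U_alg_def FactRing_def A_RCOSETS_def' U_proj_def)

lemma (in lie_module) U_proj_annihilates_iff:
  "U_proj t \<in> U_annihilator V \<longleftrightarrow> (\<forall>v\<in>carrier V. T_act V t v = \<zero>)"
proof
  show "\<forall>v\<in>carrier V. T_act V t v = \<zero>" if "U_proj t \<in> U_annihilator V"
    using that U_proj_self by (auto simp: U_annihilator_def)
next
  assume *: "\<forall>v\<in>carrier V. T_act V t v = \<zero>"
  have "T_act V s v = \<zero>" if "s \<in> U_proj t" "v \<in> carrier V" for s v
    using T_act_U_ideal[of "s - t" v] T_act_diff_eq_0_iff[of v s t] that * by (simp add: U_proj_iff)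
  then show "U_proj t \<in> U_annihilator V" by (simp add: U_annihilator_def)
qed

text \<open>A central element can be moved past any \<open>t\<close>, so it kills all
  \<open>T_act V t v\<close> once it kills the generator \<open>v\<close>.\<close>

lemma (in lie_module) U_proj_center_annihilates_iff:
  assumes "generated_by V v"
  shows "U_proj (poly_in_center f) \<in> A_annihilator V \<longleftrightarrow> T_act V (poly_in_center f) v = \<zero>"
proof -
  have v: "v \<in> carrier V" and gen: "carrier V = range (\<lambda>t. T_act V t v)"
    using assms by (auto simp: generated_by_iff)
  have "(\<forall>x\<in>carrier V. T_act V (poly_in_center f) x = \<zero>) \<longleftrightarrow> T_act V (poly_in_center f) v = \<zero>"
  proof
    assume *: "T_act V (poly_in_center f) v = \<zero>"
    show "\<forall>x\<in>carrier V. T_act V (poly_in_center f) x = \<zero>"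
    proof
      fix x assume "x \<in> carrier V"
      then obtain t where "x = T_act V t v" using gen by auto
      then show "T_act V (poly_in_center f) x = \<zero>"
        using T_act_U_ideal[OF poly_in_center_central[of f t] v] v *
        by (simp add: T_act_diff_eq_0_iff T_act_mult)
    qed
  qed (use v in simp)
  then show ?thesis
    by (auto simp: A_annihilator_def A_carrier_def U_proj_annihilates_iff)
qed

section \<open>Homomorphisms and isomorphisms\<close>

definition B_hom :: "'v B_mod \<Rightarrow> 'w B_mod \<Rightarrow> ('v \<Rightarrow> 'w) \<Rightarrow> bool"
  where "B_hom V W f \<longleftrightarrow> f \<in> carrier V \<rightarrow> carrier W \<and>
    (\<forall>v\<in>carrier V. \<forall>w\<in>carrier V. f (v \<oplus>\<^bsub>V\<^esub> w) = f v \<oplus>\<^bsub>W\<^esub> f w) \<and>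
    (\<forall>c. \<forall>v\<in>carrier V. f (c \<odot>\<^bsub>V\<^esub> v) = c \<odot>\<^bsub>W\<^esub> f v) \<and>
    (\<forall>x. \<forall>v\<in>carrier V. f (act V x v) = act W x (f v))"

lemma B_iso_iff: "B_iso V W \<longleftrightarrow> (\<exists>f. bij_betw f (carrier V) (carrier W) \<and> B_hom V W f)"
  by (auto simp: B_iso_def B_hom_def bij_betw_def)

lemma B_hom_T_act:
  assumes "lie_module V" "lie_module W" and f: "B_hom V W f" and v: "v \<in> carrier V"
  shows "f (T_act V t v) = T_act W t (f v)"
proof -
  interpret V: lie_module V by fact
  interpret W: lie_module W by fact
  have fv: "f v \<in> carrier W" using f v by (auto simp: B_hom_def)
  show ?thesis
  proof (induction t rule: poly_mapping_additive_induct)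
    case zero
    have "f (0 \<odot>\<^bsub>V\<^esub> v) = 0 \<odot>\<^bsub>W\<^esub> f v" using f v by (simp add: B_hom_def)
    then show ?case using V.smult_l_null[OF v] W.smult_l_null[OF fv] by simp
  next
    case (single w c)
    have closed: "foldr (\<lambda>p. act V (xB p)) xs v \<in> carrier V" for xs
      by (induction xs) (use v in auto)
    have "f (foldr (\<lambda>p. act V (xB p)) xs v) = foldr (\<lambda>p. act W (xB p)) xs (f v)" for xs
      by (induction xs) (use f closed in \<open>auto simp: B_hom_def\<close>)
    then show ?case
      using f v fv closed by (simp add: V.word_act_def W.word_act_def B_hom_def)
  next
    case (add s t)
    then show ?case using f v fv by (simp add: V.T_act_add W.T_act_add B_hom_def)
  qed
qed

lemma B_iso_refl: "B_iso V V"
  unfolding B_iso_def by (intro exI[of _ id]) auto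

lemma B_iso_sym:
  assumes "lie_module V" "B_iso V W"
  shows "B_iso W V"
proof -
  interpret V: lie_module V by fact
  obtain f where f: "bij_betw f (carrier V) (carrier W)" "B_hom V W f"
    using assms(2) by (auto simp: B_iso_iff)
  define g where "g = inv_into (carrier V) f"
  have g: "bij_betw g (carrier W) (carrier V)" unfolding g_def by (rule bij_betw_inv_into[OF f(1)])
  have gf: "g (f v) = v" if "v \<in> carrier V" for v
    using that f(1) by (simp add: g_def bij_betw_inv_into_left)
  have surj: "carrier W = f ` carrier V" using f(1) by (auto simp: bij_betw_def)
  have "B_hom W V g"
    unfolding B_hom_def surj using f(2)
    by (auto simp: gf B_hom_def simp flip: V.act_closed)
      (metis V.add.m_closed V.smult_closed' V.act_closed gf)+
  with g show ?thesis by (auto simp: B_iso_iff)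
qed

lemma B_iso_trans: "B_iso U V \<Longrightarrow> B_iso V W \<Longrightarrow> B_iso U W"
proof -
  assume "B_iso U V" "B_iso V W"
  then obtain f g where "bij_betw f (carrier U) (carrier V)" "B_hom U V f"
    "bij_betw g (carrier V) (carrier W)" "B_hom V W g" by (auto simp: B_iso_iff)
  then have "bij_betw (g \<circ> f) (carrier U) (carrier W)" "B_hom U W (g \<circ> f)"
    by (auto intro: bij_betw_trans simp: B_hom_def Pi_iff)
  then show "B_iso U W" by (auto simp: B_iso_iff)
qed

lemma B_iso_annihilator:
  assumes "lie_module V" "lie_module W" "B_iso V W"
  shows "A_annihilator V = A_annihilator W"
proof -
  interpret V: lie_module V by fact
  interpret W: lie_module W by fact
  obtain f where f: "bij_betw f (carrier V) (carrier W)" "B_hom V W f"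
    using assms(3) by (auto simp: B_iso_iff)
  have surj: "carrier W = f ` carrier V" and inj: "inj_on f (carrier V)"
    using f(1) by (auto simp: bij_betw_def)
  have zero: "f \<zero>\<^bsub>V\<^esub> = \<zero>\<^bsub>W\<^esub>"
    using B_hom_T_act[OF assms(1,2) f(2) V.zero_closed, of 0] by simp
  have "T_act W t (f v) = \<zero>\<^bsub>W\<^esub> \<longleftrightarrow> T_act V t v = \<zero>\<^bsub>V\<^esub>" if "v \<in> carrier V" for t v
    using that inj unfolding B_hom_T_act[OF assms(1,2) f(2) that, symmetric] zero[symmetric]
    by (auto dest: inj_onD)
  then show ?thesis by (auto simp: A_annihilator_def U_annihilator_def surj)
qed

section \<open>Cyclic modules as quotients of the tensor algebra\<close>

definition coset :: "TB set \<Rightarrow> TB \<Rightarrow> TB set"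
  where "coset J t = {s. s - t \<in> J}"

definition coset_rep :: "TB set \<Rightarrow> TB"
  where "coset_rep C = (SOME t. t \<in> C)"

text \<open>The operations choose representatives; \<open>quotient_mod_simps\<close> shows that the
  choice does not matter. The values of \<open>mult\<close> and \<open>one\<close> are
  dummies.\<close>

definition quotient_mod :: "TB set \<Rightarrow> TB set B_mod"
  where "quotient_mod J = \<lparr>carrier = range (coset J), monoid.mult = (\<lambda>_ _. {}), one = {},
    ring.zero = coset J 0, add = (\<lambda>C D. coset J (coset_rep C + coset_rep D)),
    module.smult = (\<lambda>c C. coset J (single 0 c * coset_rep C)), act = (\<lambda>x C. coset J (\<iota> x * coset_rep C))\<rparr>"

text \<open>These are the preimages in the tensor algebra of the left ideals of the enveloping
  algebra.\<close>

locale left_ideal =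
  fixes J :: "TB set"
  assumes U_ideal_subset: "t \<in> U_ideal \<Longrightarrow> t \<in> J"
    and J_add: "s \<in> J \<Longrightarrow> t \<in> J \<Longrightarrow> s + t \<in> J"
    and J_mult: "t \<in> J \<Longrightarrow> s * t \<in> J"
begin

lemma J_0: "0 \<in> J"
  by (intro U_ideal_subset U_ideal_closed)

lemma J_diff: "s \<in> J \<Longrightarrow> t \<in> J \<Longrightarrow> s - t \<in> J"
  using J_add[of s "-1 * t"] J_mult[of t "-1"] by simp

lemma J_sum: "(\<And>i. i \<in> A \<Longrightarrow> f i \<in> J) \<Longrightarrow> sum f A \<in> J"
  by (induction A rule: infinite_finite_induct) (auto simp: J_0 J_add)

lemma J_trans: "s - t \<in> J \<Longrightarrow> t - u \<in> J \<Longrightarrow> s - u \<in> J"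
  using J_add[of "s - t" "t - u"] by simp

lemma J_diff_iff: "s - t \<in> J \<Longrightarrow> s \<in> J \<longleftrightarrow> t \<in> J"
  using J_add[of "s - t" t] J_diff[of s "s - t"] by auto

text \<open>Modulo \<open>U_ideal\<close> a central factor may be moved to the left. This is what
  permits coefficients on the right in \<open>normal_form\<close>.\<close>

lemma J_mult_center: "t \<in> J \<Longrightarrow> t * poly_in_center f \<in> J"
  using J_diff[OF J_mult[of t "poly_in_center f"] U_ideal_subset[OF poly_in_center_central[of f t]]] by simp

lemma coset_eq_iff: "coset J s = coset J t \<longleftrightarrow> s - t \<in> J"
proof
  assume "coset J s = coset J t"
  moreover have "s \<in> coset J s" by (simp add: coset_def J_0)
  ultimately show "s - t \<in> J" by (auto simp: coset_def)
next
  assume st: "s - t \<in> J"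
  then have ts: "t - s \<in> J" using J_diff[OF J_0 st] by simp
  show "coset J s = coset J t"
    using J_trans[OF _ st] J_trans[OF _ ts] by (auto simp: coset_def)
qed

lemma coset_rep_coset: "coset_rep (coset J t) - t \<in> J"
proof -
  have "t \<in> coset J t" by (simp add: coset_def J_0)
  then have "coset_rep (coset J t) \<in> coset J t" unfolding coset_rep_def by (rule someI)
  then show ?thesis by (simp add: coset_def)
qed

lemma quotient_mod_simps:
  "carrier (quotient_mod J) = range (coset J)"
  "\<zero>\<^bsub>quotient_mod J\<^esub> = coset J 0"
  "coset J s \<oplus>\<^bsub>quotient_mod J\<^esub> coset J t = coset J (s + t)"
  "c \<odot>\<^bsub>quotient_mod J\<^esub> coset J t = coset J (single 0 c * t)"
  "act (quotient_mod J) x (coset J t) = coset J (\<iota> x * t)"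
  using J_add[OF coset_rep_coset[of s] coset_rep_coset[of t]] J_mult[OF coset_rep_coset[of t]]
  by (simp_all add: quotient_mod_def coset_eq_iff algebra_simps)

lemma lie_module_quotient_mod: "lie_module (quotient_mod J)"
proof
  have group: "abelian_group (quotient_mod J)"
  proof (rule abelian_groupI)
    fix C assume "C \<in> carrier (quotient_mod J)"
    then obtain t where "C = coset J t" by (auto simp: quotient_mod_simps)
    then show "\<exists>D\<in>carrier (quotient_mod J). D \<oplus>\<^bsub>quotient_mod J\<^esub> C = \<zero>\<^bsub>quotient_mod J\<^esub>"
      by (intro bexI[of _ "coset J (- t)"]) (auto simp: quotient_mod_simps)
  qed (auto simp: quotient_mod_simps add_ac)
  have module: "module complex_ring (quotient_mod J)"
  proof (rule moduleI[OF cring_from_type_algebra group])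
    fix a b :: complex and C D
    assume "C \<in> carrier (quotient_mod J)" "D \<in> carrier (quotient_mod J)"
    then obtain s t where [simp]: "C = coset J s" "D = coset J t" by (auto simp: quotient_mod_simps)
    show "(a \<oplus>\<^bsub>complex_ring\<^esub> b) \<odot>\<^bsub>quotient_mod J\<^esub> C =
        a \<odot>\<^bsub>quotient_mod J\<^esub> C \<oplus>\<^bsub>quotient_mod J\<^esub> b \<odot>\<^bsub>quotient_mod J\<^esub> C"
      by (simp add: quotient_mod_simps single_add distrib_right)
    show "a \<odot>\<^bsub>quotient_mod J\<^esub> (C \<oplus>\<^bsub>quotient_mod J\<^esub> D) =
        a \<odot>\<^bsub>quotient_mod J\<^esub> C \<oplus>\<^bsub>quotient_mod J\<^esub> a \<odot>\<^bsub>quotient_mod J\<^esub> D"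
      by (simp add: quotient_mod_simps distrib_left)
    show "(a \<otimes>\<^bsub>complex_ring\<^esub> b) \<odot>\<^bsub>quotient_mod J\<^esub> C =
        a \<odot>\<^bsub>quotient_mod J\<^esub> (b \<odot>\<^bsub>quotient_mod J\<^esub> C)"
      by (simp add: quotient_mod_simps mult.assoc [symmetric] mult_single)
  qed (auto simp: quotient_mod_simps)
  interpret module complex_ring "quotient_mod J" by (rule module)
  have minus: "coset J s \<ominus>\<^bsub>quotient_mod J\<^esub> coset J t = coset J (s - t)" for s t
  proof -
    have "\<ominus>\<^bsub>quotient_mod J\<^esub> coset J t = coset J (- t)"
      by (rule M.minus_equality) (auto simp: quotient_mod_simps)
    then show ?thesis by (simp add: a_minus_def quotient_mod_simps)
  qed
  have bracket: "\<iota> (B_bracket x y) * t - (\<iota> x * (\<iota> y * t) - \<iota> y * (\<iota> x * t)) \<in> J" for x y t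
    using J_diff[OF J_0 U_ideal_subset[OF U_ideal_closed(4)[OF commutator_in_U_ideal[of x y], of t]]]
    by (simp add: algebra_simps)
  have scalar: "\<iota> x * (single 0 c * t) = single 0 c * (\<iota> x * t)" for x c t
    by (metis mult.assoc scalar_comm)
  show "B_module (quotient_mod J)"
    unfolding B_module_def quotient_mod_simps(1)
  proof (intro conjI allI ballI module; elim rangeE; hypsubst)
    show "act (quotient_mod J) x (coset J t) \<in> range (coset J)" for x t
      by (simp add: quotient_mod_simps)
    show "act (quotient_mod J) x (coset J s \<oplus>\<^bsub>quotient_mod J\<^esub> coset J t) =
        act (quotient_mod J) x (coset J s) \<oplus>\<^bsub>quotient_mod J\<^esub> act (quotient_mod J) x (coset J t)" for x s t
      by (simp add: quotient_mod_simps distrib_left)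
    show "act (quotient_mod J) x (c \<odot>\<^bsub>quotient_mod J\<^esub> coset J t) =
        c \<odot>\<^bsub>quotient_mod J\<^esub> act (quotient_mod J) x (coset J t)" for x c t
      by (simp add: quotient_mod_simps scalar)
    show "act (quotient_mod J) (x + y) (coset J t) =
        act (quotient_mod J) x (coset J t) \<oplus>\<^bsub>quotient_mod J\<^esub> act (quotient_mod J) y (coset J t)" for x y t
      by (simp add: quotient_mod_simps \<iota>_add distrib_right)
    show "act (quotient_mod J) (B_scale c x) (coset J t) =
        c \<odot>\<^bsub>quotient_mod J\<^esub> act (quotient_mod J) x (coset J t)" for x c t
      by (simp add: quotient_mod_simps \<iota>_scale mult.assoc)
    show "act (quotient_mod J) (B_bracket x y) (coset J t) =
        act (quotient_mod J) x (act (quotient_mod J) y (coset J t)) \<ominus>\<^bsub>quotient_mod J\<^esub>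
        act (quotient_mod J) y (act (quotient_mod J) x (coset J t))" for x y t
      by (simp add: quotient_mod_simps minus coset_eq_iff bracket)
  qed
qed

lemma T_act_quotient_mod: "T_act (quotient_mod J) t (coset J s) = coset J (t * s)"
proof -
  interpret Q: lie_module "quotient_mod J" by (rule lie_module_quotient_mod)
  have s: "coset J s \<in> carrier (quotient_mod J)" by (simp add: quotient_mod_simps)
  show ?thesis
  proof (induction t rule: poly_mapping_additive_induct)
    case (single w c)
    have "Q.word_act (Word xs) (coset J s) = coset J (single (Word xs) 1 * s)" for xs
      by (induction xs) (simp_all add: Q.word_act_Cons quotient_mod_simps letter_mult_left)
    from this[of "letters w"] show ?case
      using s by (simp add: quotient_mod_simps mult_single flip: mult.assoc)
  qed (use s in \<open>simp_all add: Q.T_act_add quotient_mod_simps distrib_right\<close>)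
qed

lemma generated_by_quotient_mod: "generated_by (quotient_mod J) (coset J 1)"
  using lie_module.generated_by_iff[OF lie_module_quotient_mod]
  by (simp add: T_act_quotient_mod quotient_mod_simps)

lemma whittaker_quotient_mod:
  assumes "\<And>x. x \<in> nil_part \<Longrightarrow> \<iota> x - single 0 (\<phi> x) \<in> J"
  shows "whittaker_module \<phi> (quotient_mod J)"
proof -
  have "whittaker_vector \<phi> (quotient_mod J) (coset J 1)"
    using assms by (auto simp: whittaker_vector_def quotient_mod_simps coset_eq_iff)
  then show ?thesis
    using generated_by_quotient_mod lie_module.B_module[OF lie_module_quotient_mod]
    by (auto simp: whittaker_module_def)
qed

end

context lie_module
begin

definition ann :: "'v \<Rightarrow> TB set"
  where "ann v = {t. T_act V t v = \<zero>}"

lemma left_ideal_ann: "v \<in> carrier V \<Longrightarrow> left_ideal (ann v)"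
  by (auto simp: left_ideal_def ann_def T_act_U_ideal T_act_add T_act_mult)

lemma B_iso_quotient_ann:
  assumes "generated_by V v"
  shows "B_iso V (quotient_mod (ann v))"
proof -
  have v: "v \<in> carrier V" and gen: "carrier V = range (\<lambda>t. T_act V t v)"
    using assms by (auto simp: generated_by_iff)
  interpret J: left_ideal "ann v" using v by (rule left_ideal_ann)
  \<comment> \<open>The fibres of the orbit map of \<open>v\<close> are the cosets of its
    annihilator, so the isomorphism needs no choice of representatives.\<close>
  define f where "f x = {t. T_act V t v = x}" for x
  have f: "f (T_act V t v) = coset (ann v) t" for t
    using v by (auto simp: f_def coset_def ann_def T_act_diff_eq_0_iff)
  have "bij_betw f (carrier V) (carrier (quotient_mod (ann v)))"
    unfolding bij_betw_def
  proof
    show "inj_on f (carrier V)"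
    proof (rule inj_onI)
      fix x y assume "x \<in> carrier V" "y \<in> carrier V" "f x = f y"
      then obtain s t where "x = T_act V s v" "y = T_act V t v" "s - t \<in> ann v"
        unfolding gen by (auto simp: f J.coset_eq_iff)
      then show "x = y" using v by (simp add: ann_def T_act_diff_eq_0_iff)
    qed
    show "f ` carrier V = carrier (quotient_mod (ann v))"
      by (simp add: gen image_image f J.quotient_mod_simps)
  qed
  moreover have "B_hom V (quotient_mod (ann v)) f"
    unfolding B_hom_def gen using v
    by (auto simp: f J.quotient_mod_simps simp flip: T_act_add T_act_mult T_act_scalar T_act_\<iota>
        simp del: T_act_single T_act_\<iota>)
  ultimately show ?thesis by (auto simp: B_iso_iff)
qed

end

section \<open>Normal forms\<close>

definition sorted_word :: "(int \<times> nat) multiset \<Rightarrow> TB"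
  where "sorted_word w = single (Word (sorted_list_of_multiset w)) 1"

text \<open>A lift of the induced module to the tensor algebra. With the coefficients on the right,
  a letter acting from the left meets the sorted word directly.\<close>

definition normal_form :: "((int \<times> nat) multiset \<Rightarrow>\<^sub>0 complex poly) \<Rightarrow> TB"
  where "normal_form u = (\<Sum>w\<in>keys u. sorted_word w * poly_in_center (lookup u w))"

lemma normal_form_superset:
  "finite A \<Longrightarrow> keys u \<subseteq> A \<Longrightarrow> normal_form u = (\<Sum>w\<in>A. sorted_word w * poly_in_center (lookup u w))"
  unfolding normal_form_def by (intro sum.mono_neutral_left) (auto simp: in_keys_iff)

lemma normal_form_add: "normal_form (u + v) = normal_form u + normal_form v"
  using keys_add[of u v]
  by (simp add: normal_form_superset[of "keys u \<union> keys v"] lookup_add poly_in_center_add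
      distrib_left sum.distrib)

lemma normal_form_0 [simp]: "normal_form 0 = 0"
  by (simp add: normal_form_def)

lemma normal_form_single [simp]: "normal_form (single w f) = sorted_word w * poly_in_center f"
  by (simp add: normal_form_superset[of "{w}"])

lemma sorted_word_empty [simp]: "sorted_word {#} = 1"
  by (simp add: sorted_word_def)

lemma normal_form_scalar: "normal_form (single 0 f * u) = normal_form u * poly_in_center f"
proof -
  have "keys (single 0 f * u) \<subseteq> keys u" by (auto simp: in_keys_iff)
  then show ?thesis
    by (simp add: normal_form_superset[of "keys u"] sum_distrib_right mult.assoc mult.commute[of f]
        flip: poly_in_center_mult)
qed

lemma normal_form_sum: "normal_form (sum f A) = (\<Sum>i\<in>A. normal_form (f i))"
  by (induction A rule: infinite_finite_induct) (auto simp: normal_form_add)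

lemma normal_form_coeff_poly:
  "normal_form (single 0 (coeff_poly p q) * u) = single 0 (of_int (coeff_int p q)) * normal_form u"
  by (simp add: coeff_poly_def normal_form_scalar of_int_poly scalar_comm del: single_of_int)

lemma normal_form_1 [simp]: "normal_form 1 = 1"
  using normal_form_single[of "{#}" 1] by simp

lemma single_const_add: "single w [:a + b:] = single w [:a:] + single w [:b:]"
  by (simp flip: single_add)

section \<open>The universal module over the Lie algebra\<close>

context whittaker_character
begin

text \<open>The induced module over \<open>\<complex>[X]\<close>, regarded as a complex module on
  which \<open>(1, 0)\<close> acts as \<open>X\<close>. The carrier is restricted to the words over
  \<open>neg_letters\<close>, on which \<open>op_bracket\<close> provides the Lie relation.\<close>

definition universal :: "((int \<times> nat) multiset \<Rightarrow>\<^sub>0 complex poly) B_mod"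
  where "universal = \<lparr>carrier = supported_on neg_words, monoid.mult = (\<lambda>_ _. 0), one = 0,
    ring.zero = 0, add = (+), module.smult = (\<lambda>c u. single 0 [:c:] * u),
    act = (\<lambda>x u. \<Sum>p\<in>keys x. single 0 [:lookup x p:] * op p u)\<rparr>"

lemma universal_simps [simp]:
  "carrier universal = supported_on neg_words" "\<zero>\<^bsub>universal\<^esub> = 0" "u \<oplus>\<^bsub>universal\<^esub> v = u + v"
  "c \<odot>\<^bsub>universal\<^esub> u = single 0 [:c:] * u"
  by (simp_all add: universal_def)

lemma act_universal_superset:
  assumes "finite A" "keys x \<subseteq> A"
  shows "act universal x u = (\<Sum>p\<in>A. single 0 [:lookup x p:] * op p u)"
  using assms by (auto simp: universal_def in_keys_iff intro!: sum.mono_neutral_left)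

lemma act_universal_add: "act universal (x + y) u = act universal x u + act universal y u"
  using keys_add[of x y]
  by (simp add: act_universal_superset[of "keys x \<union> keys y"] lookup_add single_const_add distrib_right
      sum.distrib)

lemma act_universal_scale: "act universal (B_scale c x) u = single 0 [:c:] * act universal x u"
proof -
  have "keys (B_scale c x) \<subseteq> keys x" by (auto simp: in_keys_iff)
  then show ?thesis
    by (simp add: act_universal_superset[of "keys x"] sum_distrib_left mult_single mult.commute[of c]
        flip: mult.assoc)
qed

lemma act_universal_single: "act universal (single p c) u = single 0 [:c:] * op p u"
  by (simp add: act_universal_superset[of "{p}"])

lemma act_universal_xB [simp]: "act universal (xB p) u = op p u"
  by (simp add: xB_def act_universal_single flip: one_pCons)

lemma act_universal_0 [simp]: "act universal 0 u = 0"
  by (simp add: universal_def)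

lemma act_universal_sum: "act universal (sum f A) u = (\<Sum>i\<in>A. act universal (f i) u)"
  by (induction A rule: infinite_finite_induct) (auto simp: act_universal_add)

lemma act_universal_letters: "u \<in> supported_on neg_words \<Longrightarrow> act universal x u \<in> supported_on neg_words"
  unfolding universal_def by (auto intro!: supported_on_sum supported_on_scalar_mult op_letters)

lemma act_universal_bracket:
  assumes "u \<in> supported_on neg_words"
  shows "act universal (B_bracket x y) u = act universal x (act universal y u) - act universal y (act universal x u)"
proof -
  have comm: "act universal (xB_bracket p q) u = op p (op q u) - op q (op p u)" for p q
    using op_bracket[OF assms, of p q]
    by (simp add: xB_bracket_conv act_universal_scale coeff_poly_def of_int_poly del: B_scale_xB)
  have "act universal (B_bracket x y) u =
      (\<Sum>p\<in>keys x. \<Sum>q\<in>keys y. single 0 [:lookup x p * lookup y q:] * (op p (op q u) - op q (op p u)))"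
    by (simp add: B_bracket_def act_universal_sum act_universal_scale comm)
  also have "\<dots> = (\<Sum>p\<in>keys x. \<Sum>q\<in>keys y. single 0 [:lookup x p * lookup y q:] * op p (op q u)) -
      (\<Sum>p\<in>keys x. \<Sum>q\<in>keys y. single 0 [:lookup x p * lookup y q:] * op q (op p u))"
    by (simp add: right_diff_distrib sum_subtractf)
  also have "(\<Sum>p\<in>keys x. \<Sum>q\<in>keys y. single 0 [:lookup x p * lookup y q:] * op p (op q u)) =
      act universal x (act universal y u)"
    by (simp add: universal_def op_sum op_scalar_mult sum_distrib_left mult_single mult.commute
        flip: mult.assoc)
  also have "(\<Sum>p\<in>keys x. \<Sum>q\<in>keys y. single 0 [:lookup x p * lookup y q:] * op q (op p u)) =
      act universal y (act universal x u)"
    by (subst sum.swap)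
      (simp add: universal_def op_sum op_scalar_mult sum_distrib_left mult_single mult.commute flip: mult.assoc)
  finally show ?thesis .
qed

lemma lie_module_universal: "lie_module universal"
proof
  have group: "abelian_group universal"
  proof (rule abelian_groupI)
    show "\<exists>y\<in>carrier universal. y \<oplus>\<^bsub>universal\<^esub> x = \<zero>\<^bsub>universal\<^esub>" if "x \<in> carrier universal" for x
      using supported_on_diff[of 0 neg_words x] that by (intro bexI[of _ "- x"]) auto
  qed (auto simp: supported_on_add add_ac)
  have module: "module complex_ring universal"
  proof (rule moduleI[OF cring_from_type_algebra group])
    show "(a \<oplus>\<^bsub>complex_ring\<^esub> b) \<odot>\<^bsub>universal\<^esub> u = a \<odot>\<^bsub>universal\<^esub> u \<oplus>\<^bsub>universal\<^esub> b \<odot>\<^bsub>universal\<^esub> u" for a b u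
      by (simp add: distrib_right[symmetric] single_add[symmetric])
    show "(a \<otimes>\<^bsub>complex_ring\<^esub> b) \<odot>\<^bsub>universal\<^esub> u = a \<odot>\<^bsub>universal\<^esub> (b \<odot>\<^bsub>universal\<^esub> u)" for a b u
      by (simp add: mult_single mult.commute[of a] flip: mult.assoc)
  qed (auto simp: supported_on_scalar_mult distrib_left simp flip: one_pCons)
  interpret module complex_ring universal by (rule module)
  have minus: "u \<ominus>\<^bsub>universal\<^esub> v = u - v" if "v \<in> supported_on neg_words" for u v
  proof -
    have "\<ominus>\<^bsub>universal\<^esub> v = - v"
      using supported_on_diff[of 0 neg_words v] that by (intro M.minus_equality) auto
    then show ?thesis by (simp add: a_minus_def)
  qed
  show "B_module universal"
    unfolding B_module_def
  proof (intro conjI allI ballI module)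
    show "act universal x (v \<oplus>\<^bsub>universal\<^esub> w) = act universal x v \<oplus>\<^bsub>universal\<^esub> act universal x w" for x v w
      by (simp add: universal_def op_add distrib_left sum.distrib)
    show "act universal x (c \<odot>\<^bsub>universal\<^esub> v) = c \<odot>\<^bsub>universal\<^esub> act universal x v" for x c v
      by (simp add: universal_def op_scalar_mult sum_distrib_left mult.left_commute)
    show "act universal (B_bracket x y) v = act universal x (act universal y v)
        \<ominus>\<^bsub>universal\<^esub> act universal y (act universal x v)" if "v \<in> carrier universal" for x y v
      using that by (simp add: act_universal_bracket minus act_universal_letters)
  qed (simp_all add: act_universal_letters act_universal_add act_universal_scale)
qed

sublocale universal: lie_module universal
  by (rule lie_module_universal)

abbreviation eval :: "TB \<Rightarrow> (int \<times> nat) multiset \<Rightarrow>\<^sub>0 complex poly"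
  where "eval t \<equiv> T_act universal t 1"

lemma one_in_universal [simp]:
  "(1 :: (int \<times> nat) multiset \<Rightarrow>\<^sub>0 complex poly) \<in> supported_on neg_words"
  using supported_on_single[of "{#}" neg_words "1 :: complex poly"] by simp

lemma eval_letters: "eval t \<in> supported_on neg_words"
  using universal.T_act_closed[of 1 t] by simp

text \<open>Polynomials in the centre act faithfully on the Whittaker vector. This is why every
  ideal will occur as an annihilator.\<close>

lemma eval_poly_in_center: "eval (poly_in_center f) = single 0 f"
proof (induction f)
  case (pCons a f)
  have "eval (letter (1, 0) * poly_in_center f) = op (1, 0) (single 0 f)"
    using pCons by (simp add: universal.T_act_mult eval_letters universal.word_act_Cons supported_on_single flip: one_pCons)
  also have "\<dots> = single 0 [:0, 1:] * single 0 f"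
    by (rule op_center) (simp add: supported_on_single)
  finally show ?case
    by (simp add: poly_in_center_pCons universal.T_act_add mult_single single_add[symmetric] flip: one_pCons)
qed simp

lemma \<phi>_linear:
  shows "x \<in> nil_part \<Longrightarrow> y \<in> nil_part \<Longrightarrow> \<phi> (x + y) = \<phi> x + \<phi> y"
    "x \<in> nil_part \<Longrightarrow> \<phi> (B_scale c x) = c * \<phi> x"
  using good by (auto simp: good_character_def lie_character_def)

lemma nil_part_grade: "grade p \<ge> 1 \<Longrightarrow> xB p \<in> nil_part"
  by (cases p) (auto simp: nil_part_def grade_def intro!: B.span_base)

lemma act_nil_part_one: "x \<in> nil_part \<Longrightarrow> act universal x 1 = single 0 [:\<phi> x:]"
proof -
  \<comment> \<open>Membership is carried through the span induction, because \<open>\<phi>\<close>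
    is linear only on \<open>nil_part\<close>.\<close>
  have "x \<in> nil_part \<and> act universal x 1 = single 0 [:\<phi> x:]" if "x \<in> nil_part"
    using that unfolding nil_part_def
  proof (induction rule: B.span_induct_alt)
    case base
    have "0 \<in> nil_part" unfolding nil_part_def by (rule B.span_zero)
    moreover have "\<phi> 0 = 0" using \<phi>_linear(1)[OF \<open>0 \<in> nil_part\<close> \<open>0 \<in> nil_part\<close>] by simp
    ultimately show ?case by (simp add: nil_part_def)
  next
    case (step c x y)
    then obtain p where p: "x = xB p" "grade p \<ge> 1" by (auto simp: grade_def)
    then have x: "x \<in> nil_part" using nil_part_grade by simp
    have "p \<notin> neg_letters" "p \<noteq> (1, 0)" using p(2) by (auto simp: neg_letters_def grade_def)
    then have "act universal x 1 = single 0 [:\<phi> x:]"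
      by (simp add: p(1) act1_def top_def central_char_def)
    moreover have "B_scale c x \<in> nil_part" "y \<in> nil_part"
      using x step unfolding nil_part_def by (auto intro: B.span_scale)
    moreover have "B_scale c x + y \<in> nil_part"
      using calculation(2,3) unfolding nil_part_def by (rule B.span_add)
    ultimately show ?case
      using step x by (simp add: nil_part_def[symmetric] act_universal_add act_universal_scale \<phi>_linear mult_single mult.commute[of c]
          flip: single_add)
  qed
  then show "x \<in> nil_part \<Longrightarrow> act universal x 1 = single 0 [:\<phi> x:]" by blast
qed

end

text \<open>The model case is the annihilator of a Whittaker vector. All such ideals are compared
  with the same universal module, and thereby with each other.\<close>

locale whittaker_left_ideal = whittaker_character + left_ideal +
  assumes whittaker: "grade p \<ge> 1 \<Longrightarrow> letter p - single 0 (\<phi> (xB p)) \<in> J"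
begin

lemma letter_normal_form_linear:
  assumes "u \<in> supported_on S" "\<And>w. w \<in> S \<Longrightarrow> letter p * sorted_word w - normal_form (act1 p w) \<in> J"
  shows "letter p * normal_form u - normal_form (op p u) \<in> J"
proof -
  have "letter p * normal_form u - normal_form (op p u) =
      (\<Sum>w\<in>keys u. (letter p * sorted_word w - normal_form (act1 p w)) * poly_in_center (lookup u w))"
    by (simp add: normal_form_def[of u] op_def lin_ext_def normal_form_sum normal_form_scalar
        sum_distrib_left sum_subtractf left_diff_distrib mult.assoc)
  also have "\<dots> \<in> J"
    using assms by (intro J_sum J_mult_center) (auto simp: supported_on_def)
  finally show ?thesis .
qed

text \<open>Straightening modulo \<open>J\<close> follows the recursion behind \<open>act1\<close>:
  the Whittaker condition settles the empty word, and the commutator relation moves \<open>p\<close>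
  past the least letter.\<close>

lemma letter_sorted_list:
  "sorted xs \<Longrightarrow> set xs \<subseteq> neg_letters \<Longrightarrow>
    letter p * single (Word xs) 1 - normal_form (act1 p (mset xs)) \<in> J"
proof (induction "length xs" arbitrary: p xs rule: less_induct)
  case less
  have sort: "sorted_list_of_multiset (mset xs) = xs" using less.prems(1) by (simp add: sorted_sort_id)
  show ?case
  proof (cases xs)
    case Nil
    consider "p \<in> neg_letters" | "p = (1, 0)" | "grade p \<ge> 1" "p \<noteq> (1, 0)" "p \<notin> neg_letters"
      by (cases "p = (1, 0)"; cases "grade p \<le> 0") (auto simp: neg_letters_def)
    then show ?thesis
    proof cases
      case 2
      then have "p \<notin> neg_letters" by (simp add: neg_letters_def)
      with 2 Nil show ?thesis
        by (simp add: act1_def top_def central_char_def poly_in_center_pCons J_0)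
    next
      case 3
      then show ?thesis using whittaker[of p] Nil
        by (simp add: act1_def top_def central_char_def)
    qed (use Nil in \<open>simp add: act1_def top_def sorted_word_def J_0\<close>)
  next
    case (Cons q ys)
    have q: "q \<in> neg_letters" "\<forall>y\<in>#mset ys. q \<le> y" and ys: "sorted ys" "set ys \<subseteq> neg_letters"
      using less.prems by (auto simp: Cons)
    have sort_ys: "sorted_list_of_multiset (mset ys) = ys" using ys(1) by (simp add: sorted_sort_id)
    show ?thesis
    proof (cases "p \<in> neg_letters \<and> p < q")
      case True
      then have le: "\<forall>x\<in>#mset xs. p \<le> x" using q(2) by (auto simp: Cons)
      then have "act1 p (mset xs) = single (add_mset p (mset xs)) 1"
        using True by (intro act1_min) auto
      moreover have "sorted_word (add_mset p (mset xs)) = single (Word (p # xs)) 1"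
        by (simp only: sorted_word_def sorted_list_of_add_min[OF le] sort)
      ultimately show ?thesis by (simp add: letter_mult J_0)
    next
      case False
      have IH: "letter p * single (Word zs) 1 - normal_form (act1 p (mset zs)) \<in> J"
        if "length zs \<le> length ys" "sorted zs" "set zs \<subseteq> neg_letters" for p zs
        using less.hyps[of zs p] that by (simp add: Cons)
      \<comment> \<open>The words of \<open>low p ys\<close> are no longer than \<open>ys\<close>
        and fall under the induction hypothesis. The word of \<open>top p (mset ys)\<close> may be
        longer, but prepending \<open>q\<close> leaves it sorted.\<close>
      have min: "letter q * normal_form (act1 p (mset ys)) - normal_form (op q (act1 p (mset ys))) \<in> J"
      proof -
        have "letter q * normal_form (low p ys) - normal_form (op q (low p ys)) \<in> J"
        proof (rule letter_normal_form_linear)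
          show "low p ys \<in> supported_on {w. size w \<le> length ys \<and> set_mset w \<subseteq> neg_letters}"
            using low_size[of p ys] low_letters[OF ys(2), of p] by (auto simp: supported_on_def)
          show "letter q * sorted_word w - normal_form (act1 q w) \<in> J"
            if "w \<in> {w. size w \<le> length ys \<and> set_mset w \<subseteq> neg_letters}" for w
            using IH[of "sorted_list_of_multiset w" q] that
            by (auto simp: sorted_word_def simp flip: size_mset)
        qed
        moreover have "letter q * normal_form (top p (mset ys)) = normal_form (op q (top p (mset ys)))"
        proof (cases "p \<in> neg_letters")
          case True
          then have le: "\<forall>y\<in>#add_mset p (mset ys). q \<le> y" using False q(2) by auto
          then have "sorted_word (add_mset q (add_mset p (mset ys))) = letter q * sorted_word (add_mset p (mset ys))"
            by (simp only: sorted_word_def sorted_list_of_add_min[OF le] letter_mult)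
          then show ?thesis using True act1_min[OF q(1) le] by (simp add: top_def)
        qed (simp add: top_def)
        ultimately show ?thesis
          by (simp add: act1_def op_add normal_form_add distrib_left sorted_sort_id[OF ys(1)])
      qed
      have act: "act1 p (mset xs) = op q (act1 p (mset ys)) + single 0 (coeff_poly p q) * act1 (target p q) (mset ys)"
        unfolding Cons mset.simps using q False by (intro act1_add_min) auto
      let ?W = "single (Word ys) 1"
      have "(letter p * letter q - letter q * letter p - single (Word [target p q]) (of_int (coeff_int p q))) * ?W \<in> J"
        using U_ideal_closed(4)[OF letter_commutator] by (rule U_ideal_subset)
      moreover have "letter q * (letter p * ?W - normal_form (act1 p (mset ys))) \<in> J"
        using IH[of ys p] ys by (intro J_mult) auto
      moreover have "single 0 (of_int (coeff_int p q)) * (letter (target p q) * ?W - normal_form (act1 (target p q) (mset ys))) \<in> J"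
        using IH[of ys "target p q"] ys by (intro J_mult) auto
      \<comment> \<open>Four members of \<open>J\<close> that telescope to the claim: exchange
        \<open>p\<close> and \<open>q\<close>, straighten \<open>p ys\<close>, apply
        \<open>q\<close> to the result, and straighten the bracket term.\<close>
      ultimately have "(letter p * letter q - letter q * letter p - single (Word [target p q]) (of_int (coeff_int p q))) * ?W
          + letter q * (letter p * ?W - normal_form (act1 p (mset ys)))
          + (letter q * normal_form (act1 p (mset ys)) - normal_form (op q (act1 p (mset ys))))
          + single 0 (of_int (coeff_int p q)) * (letter (target p q) * ?W - normal_form (act1 (target p q) (mset ys))) \<in> J"
        using min by (intro J_add)
      also have "single (Word [target p q]) (of_int (coeff_int p q)) =
          single 0 (of_int (coeff_int p q)) * letter (target p q)"
        by (simp add: mult_single del: single_of_int)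
      finally show ?thesis
        by (simp add: act normal_form_add normal_form_coeff_poly algebra_simps)
          (simp add: Cons letter_mult letter_mult_left)
    qed
  qed
qed

lemma letter_normal_form:
  assumes "u \<in> supported_on neg_words"
  shows "letter p * normal_form u - normal_form (op p u) \<in> J"
  using assms
proof (rule letter_normal_form_linear)
  show "letter p * sorted_word w - normal_form (act1 p w) \<in> J" if "w \<in> neg_words" for w
    using letter_sorted_list[of "sorted_list_of_multiset w" p] that by (simp add: sorted_word_def)
qed

lemma mult_normal_form:
  assumes "u \<in> supported_on neg_words"
  shows "t * normal_form u - normal_form (T_act universal t u) \<in> J"
proof (induction t rule: poly_mapping_additive_induct)
  case zero
  then show ?case by (simp add: J_0)
next
  case (single w c)
  have "single (Word xs) 1 * normal_form u - normal_form (universal.word_act (Word xs) u) \<in> J" for xs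
  proof (induction xs)
    case Nil
    then show ?case by (simp add: J_0)
  next
    case (Cons p xs)
    have "letter p * normal_form (universal.word_act (Word xs) u)
        - normal_form (op p (universal.word_act (Word xs) u)) \<in> J"
      using universal.word_act_linear(1)[of u u] assms by (intro letter_normal_form) simp
    with J_mult[OF Cons, of "letter p"]
    have "letter p * (single (Word xs) 1 * normal_form u) - normal_form (op p (universal.word_act (Word xs) u)) \<in> J"
      unfolding right_diff_distrib by (rule J_trans)
    then show ?case by (simp add: universal.word_act_Cons letter_mult_left)
  qed
  from J_mult[OF this[of "letters w"], of "single 0 c"] show ?case
    using assms
    by (simp add: normal_form_scalar right_diff_distrib mult_single scalar_comm flip: mult.assoc)
next
  case (add s t)
  then show ?case
    using J_add[OF add] assms by (simp add: universal.T_act_add normal_form_add algebra_simps)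
qed

text \<open>Modulo \<open>J\<close> letters act on normal forms as \<open>op\<close> does, so the
  preimage of \<open>J\<close> under \<open>normal_form\<close> is invariant. Its
  \<open>scalars\<close> are the polynomials in the centre that lie in \<open>J\<close>.\<close>

sublocale invariant_subspace \<phi> "{u \<in> supported_on neg_words. normal_form u \<in> J}"
proof
  fix u v assume *: "u \<in> {u \<in> supported_on neg_words. normal_form u \<in> J}"
  show "op p u \<in> {u \<in> supported_on neg_words. normal_form u \<in> J}" for p
    using * J_diff_iff[OF letter_normal_form[of u p]] J_mult by (simp add: op_letters)
  show "single 0 [:a:] * u \<in> {u \<in> supported_on neg_words. normal_form u \<in> J}" for a
    using * by (simp add: normal_form_scalar supported_on_scalar_mult scalar_comm J_mult)
  show "u + v \<in> {u \<in> supported_on neg_words. normal_form u \<in> J}"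
    if "v \<in> {u \<in> supported_on neg_words. normal_form u \<in> J}"
    using * that by (simp add: normal_form_add supported_on_add J_add)
qed (auto simp: J_0)

text \<open>Each \<open>t\<close> is congruent to the normal form of \<open>eval t\<close>, and
  \<open>coefficients_in_scalars\<close> tests normal forms by their coefficients. As
  \<open>eval\<close> does not depend on \<open>J\<close>, the polynomials in the centre determine
  \<open>J\<close>.\<close>

theorem mem_iff_coefficients: "t \<in> J \<longleftrightarrow> (\<forall>w. poly_in_center (lookup (eval t) w) \<in> J)"
proof -
  have scalars: "f \<in> scalars \<longleftrightarrow> poly_in_center f \<in> J" for f
    by (simp add: scalars_def supported_on_single)
  have "t - normal_form (eval t) \<in> J"
    using mult_normal_form[of 1 t] by simp
  then have "t \<in> J \<longleftrightarrow> normal_form (eval t) \<in> J" by (rule J_diff_iff)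
  also have "\<dots> \<longleftrightarrow> (\<forall>w. poly_in_center (lookup (eval t) w) \<in> J)"
  proof
    assume "normal_form (eval t) \<in> J"
    then show "\<forall>w. poly_in_center (lookup (eval t) w) \<in> J"
      using coefficients_in_scalars[of "eval t"] eval_letters by (simp add: scalars)
  qed (auto simp: normal_form_def intro!: J_sum J_mult)
  finally show ?thesis .
qed

end

section \<open>The bijection\<close>

lemma ring_U_alg: "ring U_alg"
  unfolding U_alg_def by (rule ideal.quotient_is_ring[OF ideal_U_ideal])

lemma U_proj_hom: "U_proj \<in> ring_hom tensor_alg U_alg"
  using ideal.rcos_ring_hom[OF ideal_U_ideal] by (simp add: U_alg_def U_proj_def[abs_def])

lemma U_proj_center_hom: "(\<lambda>f. U_proj (poly_in_center f)) \<in> ring_hom ring_of_type_algebra U_alg"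
proof (rule ring_hom_memI)
  fix f g :: "complex poly"
  show "U_proj (poly_in_center (f \<otimes>\<^bsub>ring_of_type_algebra\<^esub> g)) = U_proj (poly_in_center f) \<otimes>\<^bsub>U_alg\<^esub> U_proj (poly_in_center g)"
    using ring_hom_mult[OF U_proj_hom] by (simp add: poly_in_center_mult)
  show "U_proj (poly_in_center (f \<oplus>\<^bsub>ring_of_type_algebra\<^esub> g)) = U_proj (poly_in_center f) \<oplus>\<^bsub>U_alg\<^esub> U_proj (poly_in_center g)"
    using ring_hom_add[OF U_proj_hom] by (simp add: poly_in_center_add)
qed (use ring_hom_one[OF U_proj_hom] in simp_all)

lemma ring_A_alg: "ring A_alg"
proof -
  interpret h: ring_hom_ring "ring_of_type_algebra" U_alg "\<lambda>f. U_proj (poly_in_center f)"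
    by (intro ring_hom_ringI2 ring_type_algebra ring_U_alg U_proj_center_hom)
  have "subring (range (\<lambda>f. U_proj (poly_in_center f))) U_alg"
    using h.img_is_subring[OF h.R.carrier_is_subring] by simp
  moreover have "A_carrier = range (\<lambda>f. U_proj (poly_in_center f))"
    by (auto simp: A_carrier_def)
  ultimately show ?thesis
    unfolding A_alg_def using ring.subring_is_ring[OF ring_U_alg] by simp
qed

lemma A_alg_simps:
  "carrier A_alg = range (\<lambda>f. U_proj (poly_in_center f))"
  "\<zero>\<^bsub>A_alg\<^esub> = U_proj (poly_in_center 0)"
  "U_proj (poly_in_center f) \<oplus>\<^bsub>A_alg\<^esub> U_proj (poly_in_center g) = U_proj (poly_in_center (f + g))"
  "U_proj (poly_in_center f) \<otimes>\<^bsub>A_alg\<^esub> U_proj (poly_in_center g) = U_proj (poly_in_center (f * g))"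
proof -
  interpret h: ring_hom_ring "ring_of_type_algebra" U_alg "\<lambda>f. U_proj (poly_in_center f)"
    by (intro ring_hom_ringI2 ring_type_algebra ring_U_alg U_proj_center_hom)
  show "\<zero>\<^bsub>A_alg\<^esub> = U_proj (poly_in_center 0)"
    using h.hom_zero by (simp add: A_alg_def)
qed (use ring_hom_add[OF U_proj_center_hom] ring_hom_mult[OF U_proj_center_hom] in
  \<open>auto simp: A_alg_def A_carrier_def\<close>)

lemma ideal_A_annihilator:
  assumes "lie_module V" "generated_by V v"
  shows "ideal (A_annihilator V) A_alg"
proof -
  interpret lie_module V by fact
  interpret A: ring A_alg by (rule ring_A_alg)
  have v: "v \<in> carrier V" using assms(2) by (simp add: generated_by_def)
  note mem = U_proj_center_annihilates_iff[OF assms(2)]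
  have carrier: "A_annihilator V \<subseteq> carrier A_alg"
    by (auto simp: A_annihilator_def A_carrier_def A_alg_simps)
  have mult: "a \<otimes>\<^bsub>A_alg\<^esub> b \<in> A_annihilator V"
    if ab: "a \<in> carrier A_alg" "b \<in> carrier A_alg" "a \<in> A_annihilator V \<or> b \<in> A_annihilator V" for a b
  proof -
    obtain f g where "a = U_proj (poly_in_center f)" "b = U_proj (poly_in_center g)"
      using ab(1,2) by (auto simp: A_alg_simps)
    moreover have "T_act V (poly_in_center (f * g)) v = \<zero>\<^bsub>V\<^esub>"
      if "T_act V (poly_in_center f) v = \<zero>\<^bsub>V\<^esub> \<or> T_act V (poly_in_center g) v = \<zero>\<^bsub>V\<^esub>"
      for f g
    proof -
      have "T_act V (poly_in_center (f * g)) v = T_act V (poly_in_center f) (T_act V (poly_in_center g) v)" for f g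
        using v by (simp add: poly_in_center_mult T_act_mult)
      from this[of f g] this[of g f] show ?thesis using that by (auto simp: mult.commute[of g])
    qed
    ultimately show ?thesis using ab(3) by (auto simp: A_alg_simps mem)
  qed
  show ?thesis
  proof (rule idealI[OF ring_A_alg])
    show "subgroup (A_annihilator V) (add_monoid A_alg)"
    proof (rule A.add.subgroupI)
      show "A_annihilator V \<noteq> {}" using mem[of 0] by auto
      show "\<ominus>\<^bsub>A_alg\<^esub> a \<in> A_annihilator V" if "a \<in> A_annihilator V" for a
        using mult[of "\<ominus>\<^bsub>A_alg\<^esub> \<one>\<^bsub>A_alg\<^esub>" a] that carrier A.l_minus[of "\<one>\<^bsub>A_alg\<^esub>" a] by auto
      show "a \<oplus>\<^bsub>A_alg\<^esub> b \<in> A_annihilator V" if ab: "a \<in> A_annihilator V" "b \<in> A_annihilator V" for a b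
      proof -
        obtain f g where "a = U_proj (poly_in_center f)" "b = U_proj (poly_in_center g)"
          using subsetD[OF carrier ab(1)] subsetD[OF carrier ab(2)] by (auto simp: A_alg_simps)
        moreover have "T_act V (poly_in_center (f + g)) v = \<zero>\<^bsub>V\<^esub>"
          if "T_act V (poly_in_center f) v = \<zero>\<^bsub>V\<^esub>" "T_act V (poly_in_center g) v = \<zero>\<^bsub>V\<^esub>"
          using that v by (simp add: poly_in_center_add T_act_add)
        ultimately show ?thesis using ab by (auto simp: A_alg_simps mem)
      qed
    qed (use carrier in auto)
  qed (use mult carrier in auto)
qed

lemma whittaker_moduleE:
  assumes "whittaker_module \<phi> V"
  obtains v where "lie_module V" "generated_by V v" "v \<in> carrier V"
    "\<forall>x\<in>nil_part. act V x v = \<phi> x \<odot>\<^bsub>V\<^esub> v"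
proof -
  obtain v where v: "whittaker_vector \<phi> V v" "generated_by V v" and "lie_module V"
    using assms by (auto simp: whittaker_module_def lie_module_def)
  then show thesis by (intro that[of v]) (simp_all add: whittaker_vector_def)
qed

lemma (in lie_module) whittaker_in_ann:
  assumes "v \<in> carrier V" "\<forall>x\<in>nil_part. act V x v = \<phi> x \<odot> v" "x \<in> nil_part"
  shows "\<iota> x - single 0 (\<phi> x) \<in> ann v"
  using assms by (simp add: ann_def T_act_diff_eq_0_iff)

section \<open>Injectivity and surjectivity\<close>

context whittaker_character
begin

lemma ann_eqI:
  assumes "whittaker_left_ideal \<phi> J" "whittaker_left_ideal \<phi> J'"
    and "\<And>f. poly_in_center f \<in> J \<longleftrightarrow> poly_in_center f \<in> J'"
  shows "J = J'"
  using whittaker_left_ideal.mem_iff_coefficients[OF assms(1)]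
    whittaker_left_ideal.mem_iff_coefficients[OF assms(2)] assms(3) by blast

lemma whittaker_left_ideal_ann:
  assumes "lie_module V" "v \<in> carrier V" "\<forall>x\<in>nil_part. act V x v = \<phi> x \<odot>\<^bsub>V\<^esub> v"
  shows "whittaker_left_ideal \<phi> (lie_module.ann V v)"
proof -
  interpret lie_module V by fact
  interpret left_ideal "ann v" using assms(2) by (rule left_ideal_ann)
  show ?thesis
    by unfold_locales (use whittaker_in_ann[of v \<phi>, OF assms(2,3) nil_part_grade] in simp)
qed

text \<open>Each module is the quotient by the annihilator of its generator. The two annihilators
  contain the same polynomials in the centre and are therefore equal.\<close>

theorem B_iso_of_A_annihilator_eq:
  assumes "whittaker_module \<phi> V" "whittaker_module \<phi> W" "A_annihilator V = A_annihilator W"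
  shows "B_iso V W"
proof -
  obtain v where V: "lie_module V" and v: "generated_by V v" "v \<in> carrier V"
    "\<forall>x\<in>nil_part. act V x v = \<phi> x \<odot>\<^bsub>V\<^esub> v"
    using assms(1) by (rule whittaker_moduleE)
  obtain w where W: "lie_module W" and w: "generated_by W w" "w \<in> carrier W"
    "\<forall>x\<in>nil_part. act W x w = \<phi> x \<odot>\<^bsub>W\<^esub> w"
    using assms(2) by (rule whittaker_moduleE)
  have "lie_module.ann V v = lie_module.ann W w"
  proof (rule ann_eqI)
    show "poly_in_center f \<in> lie_module.ann V v \<longleftrightarrow> poly_in_center f \<in> lie_module.ann W w" for f
      using assms(3) lie_module.U_proj_center_annihilates_iff[OF V v(1), of f]
        lie_module.U_proj_center_annihilates_iff[OF W w(1), of f]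
      by (simp add: lie_module.ann_def V W)
  qed (use V v W w in \<open>auto intro!: whittaker_left_ideal_ann\<close>)
  then show ?thesis
    using lie_module.B_iso_quotient_ann[OF V v(1)] lie_module.B_iso_quotient_ann[OF W w(1)]
      B_iso_sym[OF W] B_iso_trans by metis
qed

text \<open>The elements of \<open>universal\<close> with all coefficients in the ideal form a
  submodule, because \<open>op\<close> is linear over \<open>\<complex>[X]\<close>. The module
  sought is the quotient by it, presented through \<open>eval\<close> as a quotient of the tensor
  algebra.\<close>

theorem whittaker_module_of_ideal:
  assumes "ideal I A_alg"
  shows "\<exists>V :: TB set B_mod. whittaker_module \<phi> V \<and> A_annihilator V = I"
proof -
  interpret I: ideal I A_alg by fact
  define I' where "I' = {f. U_proj (poly_in_center f) \<in> I}"
  have I'_0: "0 \<in> I'"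
    using additive_subgroup.zero_closed[OF I.is_additive_subgroup] by (simp add: I'_def A_alg_simps)
  have I'_add: "f + g \<in> I'" if "f \<in> I'" "g \<in> I'" for f g
    using additive_subgroup.a_closed[OF I.is_additive_subgroup] that by (simp add: I'_def flip: A_alg_simps)
  have I'_mult: "g * f \<in> I'" if "f \<in> I'" for f g
    using I.I_l_closed[of "U_proj (poly_in_center f)" "U_proj (poly_in_center g)"] that
    by (simp add: I'_def A_alg_simps)
  have I'_sum: "sum h A \<in> I'" if "\<And>i. i \<in> A \<Longrightarrow> h i \<in> I'" for h :: "'a \<Rightarrow> _" and A
    using that by (induction A rule: infinite_finite_induct) (auto simp: I'_0 I'_add)
  define K :: "((int \<times> nat) multiset \<Rightarrow>\<^sub>0 complex poly) set" where "K = {u. \<forall>w. lookup u w \<in> I'}"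
  have K_0: "0 \<in> K" and K_add: "\<And>u v. u \<in> K \<Longrightarrow> v \<in> K \<Longrightarrow> u + v \<in> K"
    and K_scale: "\<And>u f. u \<in> K \<Longrightarrow> single 0 f * u \<in> K"
    by (auto simp: K_def I'_0 I'_add I'_mult lookup_add)
  have K_op: "op p u \<in> K" if "u \<in> K" for p u
    using that by (auto simp: K_def op_def lookup_lin_ext mult.commute[of "lookup u _"] intro!: I'_sum I'_mult)
  have K_T_act: "T_act universal t u \<in> K" if u: "u \<in> K" "u \<in> supported_on neg_words" for t u
  proof (induction t rule: poly_mapping_additive_induct)
    case (single w c)
    have "universal.word_act (Word xs) u \<in> K" for xs
      by (induction xs) (auto simp: universal.word_act_Cons u K_op)
    from this[of "letters w"] show ?case using u by (simp add: K_scale)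
  qed (use u in \<open>auto simp: K_0 K_add universal.T_act_add\<close>)
  define J where "J = {t. eval t \<in> K}"
  interpret J: left_ideal J
    by unfold_locales
      (auto simp: J_def universal.T_act_U_ideal K_0 universal.T_act_add K_add universal.T_act_mult
        eval_letters K_T_act)
  have nil: "\<iota> x - single 0 (\<phi> x) \<in> J" if "x \<in> nil_part" for x
  proof -
    have "eval (\<iota> x) = eval (single 0 (\<phi> x))" using act_nil_part_one[OF that] by simp
    then have "eval (\<iota> x - single 0 (\<phi> x)) = 0"
      using universal.T_act_diff_eq_0_iff[of 1 "\<iota> x" "single 0 (\<phi> x)"] by simp
    then show ?thesis by (simp add: J_def K_0)
  qed
  \<comment> \<open>The only possibly nonzero coefficient of \<open>eval (poly_in_center f)\<close>
    is \<open>f\<close>, so the quotient kills exactly the prescribed polynomials.\<close>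
  have mem: "poly_in_center f \<in> J \<longleftrightarrow> f \<in> I'" for f
    by (auto simp: J_def eval_poly_in_center K_def lookup_single when_def I'_0)
  interpret Q: lie_module "quotient_mod J" by (rule J.lie_module_quotient_mod)
  have iff: "U_proj (poly_in_center f) \<in> A_annihilator (quotient_mod J) \<longleftrightarrow> U_proj (poly_in_center f) \<in> I" for f
    unfolding Q.U_proj_center_annihilates_iff[OF J.generated_by_quotient_mod]
    by (simp add: J.T_act_quotient_mod J.quotient_mod_simps J.coset_eq_iff mem I'_def)
  moreover have "I \<subseteq> range (\<lambda>f. U_proj (poly_in_center f))"
    using additive_subgroup.a_subset[OF I.is_additive_subgroup] by (simp add: A_alg_simps)
  moreover have "A_annihilator (quotient_mod J) \<subseteq> range (\<lambda>f. U_proj (poly_in_center f))"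
    by (auto simp: A_annihilator_def A_carrier_def)
  ultimately have "A_annihilator (quotient_mod J) = I" by blast
  then show ?thesis using J.whittaker_quotient_mod[OF nil] by blast
qed

end

theorem theorem4p2p2:
  fixes \<phi> :: "B \<Rightarrow> complex"
  assumes "good_character \<phi>"
  shows
    "(\<forall>V :: 'v B_mod. whittaker_module \<phi> V \<longrightarrow>
        (\<exists>W :: TB set B_mod. whittaker_module \<phi> W \<and> B_iso V W \<and>
           A_annihilator V = A_annihilator W)) \<and>
     equiv {V :: TB set B_mod. whittaker_module \<phi> V} (whittaker_iso \<phi>) \<and>
     (A_annihilator :: TB set B_mod \<Rightarrow> _) respects whittaker_iso \<phi> \<and>
     bij_betw (\<lambda>C. the_elem (A_annihilator ` C))
       (whittaker_classes \<phi> :: TB set B_mod set set) {I. ideal I A_alg}"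
proof (intro conjI allI impI)
  interpret whittaker_character \<phi> using assms by unfold_locales
  have lie: "lie_module V" if "whittaker_module \<phi> V" for V :: "'u B_mod"
    using that by (auto simp: whittaker_module_def lie_module_def)
  show "\<exists>W :: TB set B_mod. whittaker_module \<phi> W \<and> B_iso V W \<and> A_annihilator V = A_annihilator W"
    if wm: "whittaker_module \<phi> V" for V :: "'v B_mod"
  proof -
    obtain v where V: "lie_module V" and v: "generated_by V v" "v \<in> carrier V"
      "\<forall>x\<in>nil_part. act V x v = \<phi> x \<odot>\<^bsub>V\<^esub> v"
      using wm by (rule whittaker_moduleE)
    interpret V: lie_module V by (rule V)
    interpret J: left_ideal "V.ann v" using v(2) by (rule V.left_ideal_ann)
    have iso: "B_iso V (quotient_mod (V.ann v))" by (rule V.B_iso_quotient_ann[OF v(1)])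
    moreover have "whittaker_module \<phi> (quotient_mod (V.ann v))"
      by (rule J.whittaker_quotient_mod) (rule V.whittaker_in_ann[OF v(2,3)])
    moreover have "A_annihilator V = A_annihilator (quotient_mod (V.ann v))"
      by (rule B_iso_annihilator[OF V J.lie_module_quotient_mod iso])
    ultimately show ?thesis by blast
  qed
  show equiv: "equiv {V :: TB set B_mod. whittaker_module \<phi> V} (whittaker_iso \<phi>)"
    by (intro equivI refl_onI symI transI)
      (auto simp: whittaker_iso_def B_iso_refl intro: B_iso_sym[OF lie] B_iso_trans)
  show resp: "(A_annihilator :: TB set B_mod \<Rightarrow> _) respects whittaker_iso \<phi>"
    using lie B_iso_annihilator unfolding congruent_def whittaker_iso_def by blast
  \<comment> \<open>A class is nonempty and \<open>A_annihilator\<close> is constant on it, so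
    \<open>the_elem\<close> is applied to a singleton.\<close>
  have elem: "the_elem (A_annihilator ` (whittaker_iso \<phi> `` {V})) = A_annihilator V"
    if "whittaker_module \<phi> V" for V :: "TB set B_mod"
  proof -
    have "V \<in> whittaker_iso \<phi> `` {V}" using that by (simp add: whittaker_iso_def B_iso_refl)
    then have "A_annihilator ` (whittaker_iso \<phi> `` {V}) = {A_annihilator V}"
      using resp by (auto simp: congruent_def)
    then show ?thesis by simp
  qed
  show "bij_betw (\<lambda>C. the_elem (A_annihilator ` C))
       (whittaker_classes \<phi> :: TB set B_mod set set) {I. ideal I A_alg}"
    unfolding bij_betw_def
  proof
    show "inj_on (\<lambda>C. the_elem (A_annihilator ` C)) (whittaker_classes \<phi> :: TB set B_mod set set)"
    proof (rule inj_onI)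
      fix C D :: "TB set B_mod set"
      assume "C \<in> whittaker_classes \<phi>" "D \<in> whittaker_classes \<phi>"
        and eq: "the_elem (A_annihilator ` C) = the_elem (A_annihilator ` D)"
      then obtain V W where V: "whittaker_module \<phi> V" "C = whittaker_iso \<phi> `` {V}"
        and W: "whittaker_module \<phi> W" "D = whittaker_iso \<phi> `` {W}"
        by (auto simp: whittaker_classes_def quotient_def)
      then have "A_annihilator V = A_annihilator W" using eq by (simp add: elem)
      then have "(V, W) \<in> whittaker_iso \<phi>"
        using B_iso_of_A_annihilator_eq[OF V(1) W(1)] V(1) W(1) by (simp add: whittaker_iso_def)
      then show "C = D" using V(2) W(2) equiv_class_eq[OF equiv] by simp
    qed
    show "(\<lambda>C. the_elem (A_annihilator ` C)) ` (whittaker_classes \<phi> :: TB set B_mod set set) = {I. ideal I A_alg}"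
    proof (intro equalityI subsetI)
      fix I assume "I \<in> (\<lambda>C. the_elem (A_annihilator ` C)) ` (whittaker_classes \<phi> :: TB set B_mod set set)"
      then obtain V :: "TB set B_mod" where V: "whittaker_module \<phi> V" "I = A_annihilator V"
        by (auto simp: whittaker_classes_def quotient_def elem)
      then show "I \<in> {I. ideal I A_alg}"
        using ideal_A_annihilator by (auto elim!: whittaker_moduleE)
    next
      fix I assume "I \<in> {I. ideal I A_alg}"
      then obtain V :: "TB set B_mod" where V: "whittaker_module \<phi> V" "A_annihilator V = I"
        using whittaker_module_of_ideal by blast
      then show "I \<in> (\<lambda>C. the_elem (A_annihilator ` C)) ` (whittaker_classes \<phi> :: TB set B_mod set set)"
        by (intro image_eqI[of _ _ "whittaker_iso \<phi> `` {V}"])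
          (auto simp: elem whittaker_classes_def quotient_def)
    qed
  qed
qed

end
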